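(* For every permutation $\sigma$, $\tilde{Q}(\sigma)=\tilde{P}(\sigma)$.
   Context: A permutation $\sigma=\sigma(1)\dots\sigma(n)$ of size $n$ is a word on $\{1,\dots,n\}$ containing each letter exactly once. A non-empty interval of $\sigma$ is a set of values $[j,j+h]=\{j,\dots,j+h\}$ such that $\{\sigma(i),\dots,\sigma(i+h)\}=[j,j+h]$ for some $i$. $P(\sigma)$ is the poset of all non-empty intervals of $\sigma$ (including singletons and $[1,n]$) ordered by inclusion. The standard embedded poset $\tilde{P}(\sigma)$ is the plane embedding of the Hasse diagram of $P(\sigma)$ (larger elements drawn higher) in which the minimal elements appear from left to right in the order $\{\sigma(1)\},\{\sigma(2)\},\dots,\{\sigma(n)\}$. Each element of the poset represents the interval consisting of the set of values below it. A permutation is simple if it has size at least $4$ and its only non-empty intervals are the singletons and $[1,n]$. For $\pi$ of size $k$ and permutations $\alpha_1,\dots,\alpha_k$, the inflation $\pi[\alpha_1,\dots,\alpha_k]$ is the permutation obtained from $\pi$ by replacing each $\pi(i)$ by a block $I_i$ of consecutive positions whose values form an interval, such that all elements of $I_i$ are larger than all elements of $I_j$ whenever $\pi(i)>\pi(j)$, and the elements of $I_i$ form a sequence order-isomorphic to $\alpha_i$. Write $\oplus[\alpha_1,\dots,\alpha_k]$ (resp. $\ominus[\alpha_1,\dots,\alpha_k]$) when $\pi=12\dots k$ (resp. $\pi=k\dots21$), $k\ge2$. A permutation is $\oplus$-indecomposable (resp. $\ominus$-indecomposable) if it is not of the form $\oplus[\alpha_1,\dots,\alpha_k]$ (resp.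 $\ominus[\alpha_1,\dots,\alpha_k]$) with $k\ge 2$. Every permutation of size at least $2$ can be uniquely written as $\pi[\alpha_1,\dots,\alpha_k]$ (its substitution decomposition) with either $\pi$ simple; or $\pi=12\dots k$, $k\ge2$, and all $\alpha_i$ $\oplus$-indecomposable; or $\pi=k\dots21$, $k\ge 2$, and all $\alpha_i$ $\ominus$-indecomposable. The dual claw poset of size $k$ is the poset with $k+1$ elements, of which $k$ are pairwise incomparable and the other is larger than all the rest. The argyle poset of size $k$ is the interval poset $P(12\dots k)$; it has $k$ minimal elements. The embedded poset $\tilde{Q}(\sigma)$ is defined recursively: (1) If $\sigma=1$, $\tilde{Q}(\sigma)$ is the plane embedding of the one-element poset. (2) Otherwise let $\sigma=\pi[\alpha_1,\dots,\alpha_k]$ be the substitution decomposition. (3) If $\pi$ is simple, let $R$ be the dual claw poset of size $k$; otherwise let $R$ be the argyle poset of size $k$. (4) Let $\tilde{R}$ be the plane embedding of the Hasse diagram of $R$ in which its minimal elements are labeled so that $\pi(1),\dots,\pi(k)$ appear in this order from left to right. (5) $\tilde{Q}(\sigma)$ is obtained from $\tilde{R}$ by replacing, for each $i\in[1,k]$, the minimal element $\pi(i)$ by the recursively obtained $\tilde{Q}(\alpha_i)$ (so that the maximum of $\tilde{Q}(\alpha_i)$ takes the place of $\pi(i)$). The $i$-th minimal element of $\tilde{Q}(\sigma)$ from left to right represents $\{\sigma(i)\}$, and each element of $\tilde{Q}(\sigma)$ represents the set of values represented by the minimal elements below (or equal to) it; equality is equality of plane-embedded posets under this identification. *)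

theory Defs
  imports "HOL-Analysis.Analysis"
begin

section \<open>Permutations and their intervals\<close>

text \<open>
  Permutations are words on \<open>{1..n}\<close> with \<open>n \<ge> 1\<close>.  List positions count from 0, so the letter
  written \<open>\<sigma>(i)\<close> on paper is \<open>\<sigma> ! (i - 1)\<close>.
\<close>

definition is_permutation :: "nat list \<Rightarrow> bool" where
  "is_permutation \<sigma> \<longleftrightarrow> \<sigma> \<noteq> [] \<and> distinct \<sigma> \<and> set \<sigma> = {1..length \<sigma>}"

definition intervals :: "nat list \<Rightarrow> nat set set" where
  "intervals \<sigma> =
    {{j..j + h} | j h. \<exists>i. i + h < length \<sigma> \<and> (\<lambda>t. \<sigma> ! t) ` {i..i + h} = {j..j + h}}"

definition increasing_perm :: "nat \<Rightarrow> nat list" where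
  "increasing_perm k = [1..<Suc k]"

definition decreasing_perm :: "nat \<Rightarrow> nat list" where
  "decreasing_perm k = rev (increasing_perm k)"

definition simple_permutation :: "nat list \<Rightarrow> bool" where
  "simple_permutation \<pi> \<longleftrightarrow> is_permutation \<pi> \<and> length \<pi> \<ge> 4 \<and>
     intervals \<pi> = insert {1..length \<pi>} ((\<lambda>v. {v}) ` {1..length \<pi>})"

section \<open>Substitution decomposition\<close>

text \<open>
  The block substituted for the letter at position \<open>i\<close> is shifted above all blocks
  that are substituted for smaller letters.
\<close>

definition inflate :: "nat list \<Rightarrow> nat list list \<Rightarrow> nat list" where
  "inflate \<pi> \<alpha>s = concat (map
     (\<lambda>i. map (\<lambda>x. x + (\<Sum>j | j < length \<pi> \<and> \<pi> ! j < \<pi> ! i. length (\<alpha>s ! j))) (\<alpha>s ! i))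
     [0..<length \<pi>])"

definition sum_indecomposable :: "nat list \<Rightarrow> bool" where
  "sum_indecomposable \<sigma> \<longleftrightarrow> \<not> (\<exists>\<alpha>s. length \<alpha>s \<ge> 2 \<and> (\<forall>\<alpha>\<in>set \<alpha>s. is_permutation \<alpha>) \<and>
     \<sigma> = inflate (increasing_perm (length \<alpha>s)) \<alpha>s)"

definition skew_indecomposable :: "nat list \<Rightarrow> bool" where
  "skew_indecomposable \<sigma> \<longleftrightarrow> \<not> (\<exists>\<alpha>s. length \<alpha>s \<ge> 2 \<and> (\<forall>\<alpha>\<in>set \<alpha>s. is_permutation \<alpha>) \<and>
     \<sigma> = inflate (decreasing_perm (length \<alpha>s)) \<alpha>s)"

definition is_substitution_decomposition :: "nat list \<Rightarrow> nat list \<times> nat list list \<Rightarrow> bool" where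
  "is_substitution_decomposition \<sigma> = (\<lambda>(\<pi>, \<alpha>s).
     length \<alpha>s = length \<pi> \<and> (\<forall>\<alpha>\<in>set \<alpha>s. is_permutation \<alpha>) \<and> \<sigma> = inflate \<pi> \<alpha>s \<and>
     (simple_permutation \<pi>
      \<or> length \<pi> \<ge> 2 \<and> \<pi> = increasing_perm (length \<pi>) \<and> (\<forall>\<alpha>\<in>set \<alpha>s. sum_indecomposable \<alpha>)
      \<or> length \<pi> \<ge> 2 \<and> \<pi> = decreasing_perm (length \<pi>) \<and> (\<forall>\<alpha>\<in>set \<alpha>s. skew_indecomposable \<alpha>)))"

text \<open>
  Every permutation of size at least 2 has exactly one substitution decomposition, so the
  choice operator makes no actual choice.
\<close>

definition substitution_decomposition :: "nat list \<Rightarrow> nat list \<times> nat list list" where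
  "substitution_decomposition \<sigma> = (SOME d. is_substitution_decomposition \<sigma> d)"

section \<open>Plane-embedded posets\<close>

text \<open>
  An embedded poset records, besides the order, its \<^emph>\<open>left-to-right\<close> relation on incomparable
  elements.  This is what determines an upward plane drawing up to continuous deformation: it
  gives the left-to-right orders of the lower covers of an element, of its upper covers, and of
  the minimal elements.
\<close>

record 'a embedded_poset =
  nodes :: "'a set"
  order :: "('a \<times> 'a) set"
  left :: "('a \<times> 'a) set"

definition minimals :: "('a, 'z) embedded_poset_scheme \<Rightarrow> 'a set" where
  "minimals E = {m \<in> nodes E. \<forall>x\<in>nodes E. (x, m) \<in> order E \<longrightarrow> x = m}"

definition covers :: "('a, 'z) embedded_poset_scheme \<Rightarrow> ('a \<times> 'a) set" where
  "covers E = {(x, y) \<in> order E. x \<noteq> y \<and>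
     (\<forall>z. (x, z) \<in> order E \<and> (z, y) \<in> order E \<longrightarrow> z = x \<or> z = y)}"

text \<open>Straight-line drawings of the Hasse diagram: larger elements are higher, and edges meet
  only in common end points.\<close>

definition plane_drawing :: "('a, 'z) embedded_poset_scheme \<Rightarrow> ('a \<Rightarrow> real \<times> real) \<Rightarrow> bool" where
  "plane_drawing E pt \<longleftrightarrow>
     inj_on pt (nodes E) \<and>
     (\<forall>(x, y)\<in>order E. x \<noteq> y \<longrightarrow> snd (pt x) < snd (pt y)) \<and>
     (\<forall>(x, y)\<in>covers E. \<forall>z\<in>nodes E. pt z \<in> closed_segment (pt x) (pt y) \<longrightarrow> z \<in> {x, y}) \<and>
     (\<forall>(x, y)\<in>covers E. \<forall>(x', y')\<in>covers E. (x, y) \<noteq> (x', y') \<longrightarrow>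
        closed_segment (pt x) (pt y) \<inter> closed_segment (pt x') (pt y')
          \<subseteq> pt ` ({x, y} \<inter> {x', y'}))"

text \<open>Horizontal displacement per unit of height, for the edge leading from \<open>v\<close> to \<open>w\<close>.\<close>

definition drift :: "real \<times> real \<Rightarrow> real \<times> real \<Rightarrow> real" where
  "drift v w = (fst w - fst v) / \<bar>snd w - snd v\<bar>"

definition left_as_drawn :: "('a, 'z) embedded_poset_scheme \<Rightarrow> ('a \<Rightarrow> real \<times> real) \<Rightarrow> bool" where
  "left_as_drawn E pt \<longleftrightarrow>
     (\<forall>v x y. (x, v) \<in> covers E \<and> (y, v) \<in> covers E \<longrightarrow>
        ((x, y) \<in> left E \<longleftrightarrow> drift (pt v) (pt x) < drift (pt v) (pt y))) \<and>
     (\<forall>v x y. (v, x) \<in> covers E \<and> (v, y) \<in> covers E \<longrightarrow>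
        ((x, y) \<in> left E \<longleftrightarrow> drift (pt v) (pt x) < drift (pt v) (pt y))) \<and>
     (\<forall>x\<in>minimals E. \<forall>y\<in>minimals E. snd (pt x) = snd (pt y) \<and>
        ((x, y) \<in> left E \<longleftrightarrow> fst (pt x) < fst (pt y)))"

text \<open>
  The first three conditions on \<open>left\<close> say that any two distinct elements are either
  comparable or one of them is left of the other, in a transitive way; this is how the
  left-to-right orders that are visible locally in a drawing extend to all incomparable pairs.
\<close>

definition plane_embedding :: "('a, 'z) embedded_poset_scheme \<Rightarrow> bool" where
  "plane_embedding E \<longleftrightarrow>
     partial_order_on (nodes E) (order E) \<and>
     left E \<subseteq> nodes E \<times> nodes E \<and> trans (left E) \<and>
     (\<forall>x\<in>nodes E. \<forall>y\<in>nodes E.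
        (x, y) \<in> left E \<or> (y, x) \<in> left E \<longleftrightarrow> (x, y) \<notin> order E \<and> (y, x) \<notin> order E) \<and>
     (\<exists>pt. plane_drawing E pt \<and> left_as_drawn E pt)"

definition minimals_from_left :: "('a, 'z) embedded_poset_scheme \<Rightarrow> 'a list \<Rightarrow> bool" where
  "minimals_from_left E ms \<longleftrightarrow>
     set ms = minimals E \<and> sorted_wrt (\<lambda>x y. (x, y) \<in> left E) ms"

definition inclusion_on :: "'a set set \<Rightarrow> ('a set \<times> 'a set) set" where
  "inclusion_on A = {(I, J). I \<in> A \<and> J \<in> A \<and> I \<subseteq> J}"

text \<open>\<open>E\<close> is a plane embedding of the Hasse diagram of \<open>(A, \<subseteq>)\<close> in which the minimal elements
  appear from left to right as in \<open>ms\<close>.\<close>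

definition embeds_family :: "'a set set \<Rightarrow> 'a set list \<Rightarrow> 'a set embedded_poset \<Rightarrow> bool" where
  "embeds_family A ms E \<longleftrightarrow>
     plane_embedding E \<and> nodes E = A \<and> order E = inclusion_on A \<and> minimals_from_left E ms"

text \<open>For the families to which this is applied, there is exactly one such \<open>E\<close>: see
  \<open>ex1_embeds_intervals\<close> and \<open>Rtilde_eq_Ptilde\<close> below.\<close>

definition family_embedding :: "'a set set \<Rightarrow> 'a set list \<Rightarrow> 'a set embedded_poset" where
  "family_embedding A ms = (THE E. embeds_family A ms E)"

definition Ptilde :: "nat list \<Rightarrow> nat set embedded_poset" where
  "Ptilde \<sigma> = family_embedding (intervals \<sigma>) (map (\<lambda>v. {v}) \<sigma>)"

section \<open>The recursive construction\<close>

definition dual_claw :: "nat \<Rightarrow> nat set set" where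
  "dual_claw k = insert {1..k} ((\<lambda>v. {v}) ` {1..k})"

definition argyle :: "nat \<Rightarrow> nat set set" where
  "argyle k = intervals (increasing_perm k)"

text \<open>Both posets are ordered by inclusion, and their minimal element \<open>{v}\<close> carries the label
  \<open>v\<close>.\<close>

definition Rtilde :: "nat list \<Rightarrow> nat set embedded_poset" where
  "Rtilde \<pi> = family_embedding
     (if simple_permutation \<pi> then dual_claw (length \<pi>) else argyle (length \<pi>))
     (map (\<lambda>v. {v}) \<pi>)"

text \<open>The number of minimal elements strictly to the left of \<open>m\<close>.\<close>

definition min_rank :: "('a, 'z) embedded_poset_scheme \<Rightarrow> 'a \<Rightarrow> nat" where
  "min_rank E m = card {x \<in> minimals E. (x, m) \<in> left E}"

text \<open>
  Replacing the minimal elements of \<open>R\<close>, from left to right, by the members of \<open>Es\<close>.  A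
  non-minimal element \<open>r\<close> of \<open>R\<close> becomes \<open>[r]\<close>, and an element \<open>x\<close> of the poset replacing \<open>m\<close>
  becomes \<open>m # x\<close>.  The heads thus lie in \<open>R\<close>, and an element of a replacing poset relates to
  everything outside it as \<open>m\<close> does in \<open>R\<close>; in particular the maximum of the replacing poset
  inherits the upper covers of \<open>m\<close>.
\<close>

definition replace_minimals ::
    "'a embedded_poset \<Rightarrow> 'a list embedded_poset list \<Rightarrow> 'a list embedded_poset" where
  "replace_minimals R Es =
     (let N = {[r] | r. r \<in> nodes R - minimals R} \<union>
              {m # x | m x. m \<in> minimals R \<and> x \<in> nodes (Es ! min_rank R m)};
          lift = (\<lambda>outer inner. {(p, q). p \<in> N \<and> q \<in> N \<and>
            (if hd p = hd q \<and> hd p \<in> minimals R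
             then (tl p, tl q) \<in> inner (Es ! min_rank R (hd p))
             else (hd p, hd q) \<in> outer)})
      in \<lparr>nodes = N, order = lift (order R) order, left = lift (left R) left\<rparr>)"

lemma length_inflate:
  assumes "length \<alpha>s = length \<pi>"
  shows "length (inflate \<pi> \<alpha>s) = (\<Sum>i<length \<pi>. length (\<alpha>s ! i))"
  by (simp add: inflate_def length_concat comp_def interv_sum_list_conv_sum_set_nat
      atLeast0LessThan)

lemma length_substitution_decomposition:
  assumes "is_substitution_decomposition \<sigma> d" and "\<alpha> \<in> set (snd d)"
  shows "length \<alpha> < length \<sigma>"
proof -
  obtain \<pi> \<alpha>s where d: "d = (\<pi>, \<alpha>s)" by (cases d)
  have len: "length \<alpha>s = length \<pi>" and perm: "\<And>\<beta>. \<beta> \<in> set \<alpha>s \<Longrightarrow> is_permutation \<beta>"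
    and \<sigma>: "\<sigma> = inflate \<pi> \<alpha>s" and ge2: "length \<pi> \<ge> 2"
    using assms(1) by (auto simp: d is_substitution_decomposition_def simple_permutation_def)
  obtain i where i: "i < length \<pi>" "\<alpha> = \<alpha>s ! i"
    using assms(2) len by (auto simp: d in_set_conv_nth)
  define j :: nat where "j = (if i = 0 then 1 else 0)"
  have j: "j < length \<pi>" "j \<noteq> i" using ge2 i by (auto simp: j_def)
  have "0 < length (\<alpha>s ! j)"
    using perm[of "\<alpha>s ! j"] j len by (auto simp: is_permutation_def)
  then have "length (\<alpha>s ! i) < (\<Sum>t\<in>{i, j}. length (\<alpha>s ! t))"
    using j by simp
  also have "\<dots> \<le> (\<Sum>t<length \<pi>. length (\<alpha>s ! t))"
    using i j by (intro sum_mono2) auto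
  finally show ?thesis
    using \<sigma> i len by (simp add: length_inflate)
qed

text \<open>The last branch is never reached from a permutation.  It is there so that termination can be
  shown without first proving that substitution decompositions exist.\<close>

function Qtilde :: "nat list \<Rightarrow> nat set list embedded_poset" where
  "Qtilde \<sigma> =
     (if \<sigma> = [1] then \<lparr>nodes = {[]}, order = {([], [])}, left = {}\<rparr>
      else if \<exists>d. is_substitution_decomposition \<sigma> d then
        replace_minimals (Rtilde (fst (substitution_decomposition \<sigma>)))
          (map Qtilde (snd (substitution_decomposition \<sigma>)))
      else undefined)"
  by auto
termination
proof (relation "Wellfounded.measure length", goal_cases)
  case (2 \<sigma> \<alpha>)
  then have "is_substitution_decomposition \<sigma> (substitution_decomposition \<sigma>)"
    unfolding substitution_decomposition_def by (blast intro: someI_ex)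
  then show ?case using 2(3) by (auto intro: length_substitution_decomposition)
qed simp

declare Qtilde.simps [simp del]

text \<open>The set of values represented by an element \<open>x\<close>, given that the \<open>i\<close>-th minimal element
  from the left represents \<open>\<sigma>(i)\<close>.\<close>

definition represented :: "nat list \<Rightarrow> ('a, 'z) embedded_poset_scheme \<Rightarrow> 'a \<Rightarrow> nat set" where
  "represented \<sigma> E x = {\<sigma> ! min_rank E m | m. m \<in> minimals E \<and> (m, x) \<in> order E}"

definition rename :: "('a \<Rightarrow> 'b) \<Rightarrow> 'a embedded_poset \<Rightarrow> 'b embedded_poset" where
  "rename f E =
     \<lparr>nodes = f ` nodes E, order = map_prod f f ` order E, left = map_prod f f ` left E\<rparr>"

section \<open>Existence and uniqueness of the embeddings\<close>

text \<open>In the following lemma, \<open>lo\<close> and \<open>hi\<close> are the first and the last position of a set of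
  values; the set is drawn at the point \<open>(lo + hi, hi - lo)\<close>.\<close>

lemma drift_mono:
  fixes p q p' q' :: real
  assumes "0 \<le> p" "p < p'" "0 \<le> q'" "q' < q"
  shows "(p - q) / (p + q) < (p' - q') / (p' + q')"
proof -
  have "p * q' \<le> p' * q'" using assms by (intro mult_right_mono) auto
  also have "\<dots> < p' * q" using assms by (intro mult_strict_left_mono) auto
  finally show ?thesis using assms by (simp add: divide_simps algebra_simps)
qed

lemma not_parallel:
  fixes s t x y x' y' :: real
  assumes eq: "s * x = t * x'" "s * y = t * y'" and "0 \<le> s" "0 \<le> t"
    and nn: "0 \<le> x" "0 \<le> y" "0 \<le> x'" "0 \<le> y'"
    and no: "\<not> (x \<le> x' \<and> y \<le> y')" "\<not> (x' \<le> x \<and> y' \<le> y)"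
  shows "s = 0 \<or> t = 0"
proof (rule ccontr)
  assume "\<not> (s = 0 \<or> t = 0)"
  then have pos: "0 < s" "0 < t" using assms(3,4) by auto
  have *: "a \<le> b" if "u * a = v * b" "v \<le> u" "0 < u" "0 \<le> b" for u v a b :: real
  proof -
    have "u * a \<le> u * b" using that by (simp add: mult_right_mono)
    then show ?thesis using that(3) mult_le_cancel_left_pos by blast
  qed
  show False
  proof (cases "t \<le> s")
    case True
    then show ?thesis using *[OF eq(1)] *[OF eq(2)] pos nn no by auto
  next
    case False
    then show ?thesis using *[OF eq(1)[symmetric]] *[OF eq(2)[symmetric]] pos nn no by auto
  qed
qed

lemma embeds_family_by_positions:
  fixes A :: "'a set set" and lo hi :: "'a set \<Rightarrow> nat"
  assumes lohi: "\<And>I. I \<in> A \<Longrightarrow> lo I \<le> hi I \<and> hi I < length ms"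
    and sub: "\<And>I J. I \<in> A \<Longrightarrow> J \<in> A \<Longrightarrow> I \<subseteq> J \<longleftrightarrow> lo J \<le> lo I \<and> hi I \<le> hi J"
    and ms: "\<And>i. i < length ms \<Longrightarrow> ms ! i \<in> A \<and> lo (ms ! i) = i \<and> hi (ms ! i) = i"
    and meet: "\<And>I J. I \<in> A \<Longrightarrow> J \<in> A \<Longrightarrow> max (lo I) (lo J) \<le> min (hi I) (hi J) \<Longrightarrow>
      \<exists>K\<in>A. lo K = max (lo I) (lo J) \<and> hi K = min (hi I) (hi J)"
  shows "embeds_family A ms E \<longleftrightarrow>
    E = \<lparr>nodes = A, order = inclusion_on A,
         left = {(I, J). I \<in> A \<and> J \<in> A \<and> lo I < lo J \<and> hi I < hi J}\<rparr>"
    (is "_ \<longleftrightarrow> E = ?E")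
proof
  have eqI: "I = J" if "I \<in> A" "J \<in> A" "lo I = lo J" "hi I = hi J" for I J
    using sub[of I J] sub[of J I] that by auto
  have incl: "(I, J) \<in> inclusion_on A \<longleftrightarrow> I \<in> A \<and> J \<in> A \<and> lo J \<le> lo I \<and> hi I \<le> hi J" for I J
    using sub by (auto simp: inclusion_on_def)
  have mins: "minimals F = set ms" if "nodes F = A" "order F = inclusion_on A"
    for F :: "'a set embedded_poset"
  proof -
    have "I \<in> set ms" if I: "I \<in> A" "\<forall>J\<in>A. (J, I) \<in> inclusion_on A \<longrightarrow> J = I" for I
    proof -
      have "lo I < length ms" using lohi[OF I(1)] by auto
      then have "(ms ! lo I, I) \<in> inclusion_on A" "ms ! lo I \<in> A"
        using ms[of "lo I"] lohi[OF I(1)] I(1) by (auto simp: incl)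
      then have "ms ! lo I = I" using I(2) by blast
      then show ?thesis using \<open>lo I < length ms\<close> by (metis nth_mem)
    qed
    moreover have "J = ms ! i" if "i < length ms" "(J, ms ! i) \<in> inclusion_on A" for J i
      using that ms[of i] lohi[of J] by (intro eqI) (auto simp: incl)
    ultimately show ?thesis
      using that ms by (fastforce simp: minimals_def in_set_conv_nth)
  qed
  have leaf: "(ms ! i, ms ! j) \<in> left F" if "minimals_from_left F ms" "i < j" "j < length ms"
    for F :: "'a set embedded_poset" and i j
    using that by (auto simp: minimals_from_left_def sorted_wrt_iff_nth_less)

  show "E = ?E" if E: "embeds_family A ms E"
  proof -
    have nodes: "nodes E = A" and order: "order E = inclusion_on A"
      and mfl: "minimals_from_left E ms" and tr: "trans (left E)"
      and sub: "left E \<subseteq> A \<times> A"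
      and comp: "\<And>x y. x \<in> A \<Longrightarrow> y \<in> A \<Longrightarrow>
        (x, y) \<in> left E \<or> (y, x) \<in> left E \<longleftrightarrow>
        (x, y) \<notin> inclusion_on A \<and> (y, x) \<notin> inclusion_on A"
      using E by (auto simp: embeds_family_def plane_embedding_def)
    have key: "(I, J) \<in> left E" if IJ: "I \<in> A" "J \<in> A" "lo I < lo J" "hi I < hi J" for I J
    proof (rule ccontr)
      assume "(I, J) \<notin> left E"
      then have JI: "(J, I) \<in> left E" using comp[OF IJ(1,2)] IJ by (auto simp: incl)
      let ?a = "ms ! lo I" and ?d = "ms ! hi J"
      have len: "lo I < length ms" "hi J < length ms" using lohi IJ by fastforce+
      note a = ms[OF len(1)] and d = ms[OF len(2)]
      have aI: "(?a, I) \<in> inclusion_on A" and dJ: "(?d, J) \<in> inclusion_on A"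
        using a d IJ lohi by (auto simp: incl)
      have "lo I < hi J" using IJ lohi[of I] by auto
      then have ad: "(?a, ?d) \<in> left E" using leaf[OF mfl _ len(2)] by simp
      have "(?a, J) \<in> left E \<or> (J, ?a) \<in> left E"
        using comp[of ?a J] a IJ lohi[of J] by (auto simp: incl)
      moreover have "(?a, J) \<notin> left E"
        using transD[OF tr _ JI, of ?a] comp[of ?a I] aI a IJ by blast
      moreover have "(J, ?a) \<notin> left E"
        using transD[OF tr _ ad, of J] comp[of ?d J] dJ d IJ by blast
      ultimately show False by blast
    qed
    have "left E = {(I, J). I \<in> A \<and> J \<in> A \<and> lo I < lo J \<and> hi I < hi J}" (is "_ = ?L")
    proof (intro equalityI subrelI)
      fix I J assume IJ: "(I, J) \<in> left E"
      then have A: "I \<in> A" "J \<in> A" using sub by auto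
      have "(J, I) \<notin> left E"
        using transD[OF tr IJ, of I] comp[of I I] A by (auto simp: incl)
      then have "\<not> (lo J < lo I \<and> hi J < hi I)" using key A by blast
      moreover have "(I, J) \<notin> inclusion_on A \<and> (J, I) \<notin> inclusion_on A"
        using comp[OF A] IJ by blast
      ultimately show "(I, J) \<in> ?L" using A by (auto simp: incl)
    qed (use key in auto)
    then show ?thesis using nodes order by simp
  qed

  show "embeds_family A ms E" if E: "E = ?E"
  proof -
    define pt where "pt I = (real (lo I) + real (hi I), real (hi I) - real (lo I))" for I
    have nodes: "nodes ?E = A" and order: "order ?E = inclusion_on A"
      and left: "left ?E = {(I, J). I \<in> A \<and> J \<in> A \<and> lo I < lo J \<and> hi I < hi J}" by simp_all
    note mins_E = mins[OF nodes order]
    have cov: "(I, J) \<in> covers ?E \<longleftrightarrow> I \<in> A \<and> J \<in> A \<and> I \<noteq> J \<and> lo J \<le> lo I \<and> hi I \<le> hi J \<and>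
       (\<forall>K\<in>A. lo J \<le> lo K \<and> hi K \<le> hi J \<and> lo K \<le> lo I \<and> hi I \<le> hi K \<longrightarrow> K = I \<or> K = J)"
      for I J by (auto simp: covers_def incl)
    have seg: "\<exists>s. 0 \<le> s \<and> s \<le> 1 \<and>
        p = (lo J + hi J + s * (lo I - real (lo J)) - s * (hi J - real (hi I)),
             hi J - real (lo J) - s * (lo I - real (lo J)) - s * (hi J - real (hi I)))"
      if p: "p \<in> closed_segment (pt I) (pt J)" for p I J
    proof -
      from p obtain u where "0 \<le> u" "u \<le> 1" "p = (1 - u) *\<^sub>R pt I + u *\<^sub>R pt J"
        by (auto simp: closed_segment_def)
      then show ?thesis
        by (intro exI[of _ "1 - u"]) (auto simp: pt_def algebra_simps)
    qed
    have inj: "inj_on pt A"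
      by (intro inj_onI eqI) (auto simp: pt_def)
    have up: "snd (pt I) < snd (pt J)" if "(I, J) \<in> inclusion_on A" "I \<noteq> J" for I J
      using that eqI[of I J] by (force simp: pt_def incl)
    have on_seg: "\<exists>(\<alpha> :: real) (\<beta> :: real). p = (\<alpha> + \<beta>, \<beta> - \<alpha>) \<and> lo J \<le> \<alpha> \<and> \<alpha> \<le> lo I \<and> hi I \<le> \<beta> \<and> \<beta> \<le> hi J"
      if IJ: "lo J \<le> lo I" "hi I \<le> hi J" and p: "p \<in> closed_segment (pt I) (pt J)" for p I J
    proof -
      obtain s where s: "0 \<le> s" "s \<le> 1" and
        p: "p = (lo J + hi J + s * (lo I - real (lo J)) - s * (hi J - real (hi I)),
             hi J - real (lo J) - s * (lo I - real (lo J)) - s * (hi J - real (hi I)))"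
        using seg[OF p] by blast
      have "s * (lo I - real (lo J)) \<le> lo I - real (lo J)"
           "s * (hi J - real (hi I)) \<le> hi J - real (hi I)"
        using s IJ by (auto intro!: mult_left_le_one_le)
      moreover have "0 \<le> s * (lo I - real (lo J))" "0 \<le> s * (hi J - real (hi I))"
        using s IJ by auto
      ultimately show ?thesis
        unfolding p
        by (intro exI[of _ "lo J + s * (lo I - real (lo J))"]
              exI[of _ "hi J - s * (hi J - real (hi I))"]) auto
    qed
    have vertex: "K \<in> {I, J}"
      if IJ: "(I, J) \<in> covers ?E" and K: "K \<in> A" "pt K \<in> closed_segment (pt I) (pt J)" for I J K
    proof -
      have "lo J \<le> lo I" "hi I \<le> hi J" using IJ by (auto simp: cov)
      from on_seg[OF this K(2)] have "lo J \<le> lo K \<and> hi K \<le> hi J \<and> lo K \<le> lo I \<and> hi I \<le> hi K"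
        by (auto simp: pt_def)
      then show ?thesis using IJ K by (auto simp: cov)
    qed
    have top: "p = pt J"
      if c: "(I, J) \<in> covers ?E" "(I', J) \<in> covers ?E" "I \<noteq> I'"
        and p: "p \<in> closed_segment (pt I) (pt J)" "p \<in> closed_segment (pt I') (pt J)" for p I I' J
    proof -
      let ?x = "lo I - real (lo J)" and ?y = "hi J - real (hi I)"
      let ?x' = "lo I' - real (lo J)" and ?y' = "hi J - real (hi I')"
      obtain s where s: "0 \<le> s" "s \<le> 1" and
        ps: "p = (lo J + hi J + s * ?x - s * ?y, hi J - real (lo J) - s * ?x - s * ?y)"
        using seg[OF p(1)] by blast
      obtain t where t: "0 \<le> t" "t \<le> 1" and
        pt': "p = (lo J + hi J + t * ?x' - t * ?y', hi J - real (lo J) - t * ?x' - t * ?y')"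
        using seg[OF p(2)] by blast
      have eq: "s * ?x = t * ?x'" "s * ?y = t * ?y'" using ps pt' by auto
      have nn: "0 \<le> ?x" "0 \<le> ?y" "0 \<le> ?x'" "0 \<le> ?y'" using c by (auto simp: cov)
      have no: "\<not> (?x \<le> ?x' \<and> ?y \<le> ?y')" "\<not> (?x' \<le> ?x \<and> ?y' \<le> ?y)"
        using c by (auto simp: cov)
      have "s = 0 \<or> t = 0" using not_parallel[OF eq s(1) t(1)] nn no by blast
      then show ?thesis using ps pt' by (auto simp: pt_def)
    qed
    have seg': "\<exists>s. 0 \<le> s \<and> s \<le> 1 \<and>
        p = (lo I + hi I - s * (lo I - real (lo J)) + s * (hi J - real (hi I)),
             hi I - real (lo I) + s * (lo I - real (lo J)) + s * (hi J - real (hi I)))"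
      if p: "p \<in> closed_segment (pt I) (pt J)" for p I J
    proof -
      from p obtain u where "0 \<le> u" "u \<le> 1" "p = (1 - u) *\<^sub>R pt I + u *\<^sub>R pt J"
        by (auto simp: closed_segment_def)
      then show ?thesis
        by (intro exI[of _ u]) (auto simp: pt_def algebra_simps)
    qed
    have bot: "p = pt I"
      if c: "(I, J) \<in> covers ?E" "(I, J') \<in> covers ?E" "J \<noteq> J'"
        and p: "p \<in> closed_segment (pt I) (pt J)" "p \<in> closed_segment (pt I) (pt J')" for p I J J'
    proof -
      let ?x = "lo I - real (lo J)" and ?y = "hi J - real (hi I)"
      let ?x' = "lo I - real (lo J')" and ?y' = "hi J' - real (hi I)"
      obtain s where s: "0 \<le> s" "s \<le> 1" and
        ps: "p = (lo I + hi I - s * ?x + s * ?y, hi I - real (lo I) + s * ?x + s * ?y)"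
        using seg'[OF p(1)] by blast
      obtain t where t: "0 \<le> t" "t \<le> 1" and
        pt': "p = (lo I + hi I - t * ?x' + t * ?y', hi I - real (lo I) + t * ?x' + t * ?y')"
        using seg'[OF p(2)] by blast
      have eq: "s * ?x = t * ?x'" "s * ?y = t * ?y'" using ps pt' by auto
      have nn: "0 \<le> ?x" "0 \<le> ?y" "0 \<le> ?x'" "0 \<le> ?y'" using c by (auto simp: cov)
      have no: "\<not> (?x \<le> ?x' \<and> ?y \<le> ?y')" "\<not> (?x' \<le> ?x \<and> ?y' \<le> ?y)"
        using c by (auto simp: cov)
      have "s = 0 \<or> t = 0" using not_parallel[OF eq s(1) t(1)] nn no by blast
      then show ?thesis using ps pt' by (auto simp: pt_def)
    qed
    have cross: "p \<in> pt ` ({I, J} \<inter> {I', J'})"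
      if c: "(I, J) \<in> covers ?E" "(I', J') \<in> covers ?E" "(I, J) \<noteq> (I', J')"
        and p: "p \<in> closed_segment (pt I) (pt J)" "p \<in> closed_segment (pt I') (pt J')"
      for p I J I' J'
    proof -
      have A: "I \<in> A" "J \<in> A" "I' \<in> A" "J' \<in> A"
        and le: "lo J \<le> lo I" "hi I \<le> hi J" "lo J' \<le> lo I'" "hi I' \<le> hi J'"
        using c by (auto simp: cov)
      obtain \<alpha> :: real and \<beta> :: real where ab: "p = (\<alpha> + \<beta>, \<beta> - \<alpha>)" "lo J \<le> \<alpha>" "\<alpha> \<le> lo I" "hi I \<le> \<beta>" "\<beta> \<le> hi J"
        using on_seg[OF le(1,2) p(1)] by blast
      have ab': "lo J' \<le> \<alpha>" "\<alpha> \<le> lo I'" "hi I' \<le> \<beta>" "\<beta> \<le> hi J'"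
        using on_seg[OF le(3,4) p(2)] ab(1) by auto
      have cmp: "lo J' \<le> lo I" "lo J \<le> lo I'" "hi I \<le> hi J'" "hi I' \<le> hi J"
        using ab ab' by linarith+
      have "max (lo J) (lo J') \<le> min (hi J) (hi J')"
        using le cmp lohi[OF A(1)] by auto
      then obtain K where K: "K \<in> A" "lo K = max (lo J) (lo J')" "hi K = min (hi J) (hi J')"
        using meet[OF A(2,4)] by blast
      have "K \<in> {I, J}" "K \<in> {I', J'}" using c K le cmp by (auto simp: cov)
      then consider "J = J'" | "I = I'" | "J = I'" "K = J" | "I = J'" "K = I" by auto
      then show ?thesis
      proof cases
        case 1 then show ?thesis using top[of I J I' p] c p by auto
      next
        case 2 then show ?thesis using bot[of I J J' p] c p by auto
      next
        case 3
        then have "\<alpha> = lo J" "\<beta> = hi J" using ab ab' by auto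
        then show ?thesis using 3 ab by (auto simp: pt_def)
      next
        case 4
        then have "\<alpha> = lo I" "\<beta> = hi I" using ab ab' by auto
        then show ?thesis using 4 ab by (auto simp: pt_def)
      qed
    qed
    have drawing: "plane_drawing ?E pt"
      unfolding plane_drawing_def nodes order
    proof (intro conjI)
      show "\<forall>(I, J)\<in>inclusion_on A. I \<noteq> J \<longrightarrow> snd (pt I) < snd (pt J)"
        using up by blast
      show "\<forall>(I, J)\<in>covers ?E. \<forall>K\<in>A. pt K \<in> closed_segment (pt I) (pt J) \<longrightarrow> K \<in> {I, J}"
        using vertex by blast
      show "\<forall>(I, J)\<in>covers ?E. \<forall>(I', J')\<in>covers ?E. (I, J) \<noteq> (I', J') \<longrightarrow>
          closed_segment (pt I) (pt J) \<inter> closed_segment (pt I') (pt J')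
            \<subseteq> pt ` ({I, J} \<inter> {I', J'})"
        by (intro ballI case_prodI2 impI subsetI) (use cross in blast)
    qed (rule inj)
    have lower: "drift (pt V) (pt I) < drift (pt V) (pt J)"
      if c: "(I, V) \<in> covers ?E" "(J, V) \<in> covers ?E" and l: "lo I < lo J" "hi I < hi J" for V I J
    proof -
      have le: "lo V \<le> lo I" "hi I \<le> hi V" "lo V \<le> lo J" "hi J \<le> hi V" using c by (auto simp: cov)
      have d: "drift (pt V) (pt X) =
          ((lo X - real (lo V)) - (hi V - real (hi X))) / ((lo X - real (lo V)) + (hi V - real (hi X)))"
        if "lo V \<le> lo X" "hi X \<le> hi V" for X
        using that by (simp add: drift_def pt_def algebra_simps abs_if)
      show ?thesis unfolding d[OF le(1,2)] d[OF le(3,4)]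
        using le l by (intro drift_mono) auto
    qed
    have upper: "drift (pt V) (pt I) < drift (pt V) (pt J)"
      if c: "(V, I) \<in> covers ?E" "(V, J) \<in> covers ?E" and l: "lo I < lo J" "hi I < hi J" for V I J
    proof -
      have le: "lo I \<le> lo V" "hi V \<le> hi I" "lo J \<le> lo V" "hi V \<le> hi J" using c by (auto simp: cov)
      have d: "drift (pt V) (pt X) =
          ((hi X - real (hi V)) - (lo V - real (lo X))) / ((hi X - real (hi V)) + (lo V - real (lo X)))"
        if "lo X \<le> lo V" "hi V \<le> hi X" for X
        using that by (simp add: drift_def pt_def algebra_simps abs_if)
      show ?thesis unfolding d[OF le(1,2)] d[OF le(3,4)]
        using le l by (intro drift_mono) auto
    qed
    have tri_lower: "I = J \<or> lo I < lo J \<and> hi I < hi J \<or> lo J < lo I \<and> hi J < hi I"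
      if c: "(I, V) \<in> covers ?E" "(J, V) \<in> covers ?E" for V I J
    proof -
      have "\<not> (lo I \<le> lo J \<and> hi J \<le> hi I)" "\<not> (lo J \<le> lo I \<and> hi I \<le> hi J)" if "I \<noteq> J"
        using that c by (auto simp: cov)
      then show ?thesis by linarith
    qed
    have tri_upper: "I = J \<or> lo I < lo J \<and> hi I < hi J \<or> lo J < lo I \<and> hi J < hi I"
      if c: "(V, I) \<in> covers ?E" "(V, J) \<in> covers ?E" for V I J
    proof -
      have "\<not> (lo I \<le> lo J \<and> hi J \<le> hi I)" "\<not> (lo J \<le> lo I \<and> hi I \<le> hi J)" if "I \<noteq> J"
        using that c by (auto simp: cov)
      then show ?thesis by linarith
    qed
    have in_A: "I \<in> A" "J \<in> A" if "(I, J) \<in> covers ?E" for I J using that by (auto simp: cov)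
    have low_iff: "(I, J) \<in> left ?E \<longleftrightarrow> drift (pt V) (pt I) < drift (pt V) (pt J)"
      if c: "(I, V) \<in> covers ?E" "(J, V) \<in> covers ?E" for V I J
      using tri_lower[OF c] lower[OF c] lower[OF c(2,1)] in_A[OF c(1)] in_A[OF c(2)]
      unfolding left by force
    have upp_iff: "(I, J) \<in> left ?E \<longleftrightarrow> drift (pt V) (pt I) < drift (pt V) (pt J)"
      if c: "(V, I) \<in> covers ?E" "(V, J) \<in> covers ?E" for V I J
      using tri_upper[OF c] upper[OF c] upper[OF c(2,1)] in_A[OF c(1)] in_A[OF c(2)]
      unfolding left by force
    have min_iff: "snd (pt I) = snd (pt J) \<and> ((I, J) \<in> left ?E \<longleftrightarrow> fst (pt I) < fst (pt J))"
      if "I \<in> minimals ?E" "J \<in> minimals ?E" for I J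
      using that ms unfolding mins_E left by (auto simp: in_set_conv_nth pt_def)
    have drawn: "left_as_drawn ?E pt"
      unfolding left_as_drawn_def using low_iff upp_iff min_iff by blast
    have po: "partial_order_on A (inclusion_on A)"
      by (auto simp: partial_order_on_def preorder_on_def refl_on_def inclusion_on_def
          intro!: transI antisymI)
    have comp: "(I, J) \<in> left ?E \<or> (J, I) \<in> left ?E \<longleftrightarrow>
        (I, J) \<notin> inclusion_on A \<and> (J, I) \<notin> inclusion_on A" if "I \<in> A" "J \<in> A" for I J
      using that unfolding left incl by auto
    have tr: "trans (left ?E)" unfolding left by (intro transI) auto
    have sub': "left ?E \<subseteq> A \<times> A" unfolding left by auto
    have "plane_embedding ?E"
      unfolding plane_embedding_def nodes order using po comp tr sub' drawing drawn by blast
    moreover have "minimals_from_left ?E ms"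
      unfolding minimals_from_left_def mins_E left using ms
      by (auto simp: sorted_wrt_iff_nth_less)
    ultimately show ?thesis
      unfolding E embeds_family_def by simp
  qed
qed

definition first_position :: "nat list \<Rightarrow> nat set \<Rightarrow> nat" where
  "first_position \<sigma> I = Min {t. t < length \<sigma> \<and> \<sigma> ! t \<in> I}"

definition last_position :: "nat list \<Rightarrow> nat set \<Rightarrow> nat" where
  "last_position \<sigma> I = Max {t. t < length \<sigma> \<and> \<sigma> ! t \<in> I}"

lemma intervals_iff:
  assumes "distinct \<sigma>"
  shows "I \<in> intervals \<sigma> \<longleftrightarrow>
    (\<exists>a b c d. a \<le> b \<and> b < length \<sigma> \<and> c \<le> d \<and> I = (!) \<sigma> ` {a..b} \<and> I = {c..d})"
proof
  assume "I \<in> intervals \<sigma>"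
  then obtain j h i where "i + h < length \<sigma>" "(!) \<sigma> ` {i..i + h} = {j..j + h}" "I = {j..j + h}"
    by (auto simp: intervals_def)
  then show "\<exists>a b c d. a \<le> b \<and> b < length \<sigma> \<and> c \<le> d \<and> I = (!) \<sigma> ` {a..b} \<and> I = {c..d}"
    by (intro exI[of _ i] exI[of _ "i + h"] exI[of _ j] exI[of _ "j + h"]) auto
next
  assume "\<exists>a b c d. a \<le> b \<and> b < length \<sigma> \<and> c \<le> d \<and> I = (!) \<sigma> ` {a..b} \<and> I = {c..d}"
  then obtain a b c d where *: "a \<le> b" "b < length \<sigma>" "c \<le> d" "I = (!) \<sigma> ` {a..b}" "I = {c..d}"
    by blast
  have "card I = card {a..b}"
    unfolding *(4) using * assms by (intro card_image) (auto simp: inj_on_def nth_eq_iff_index_eq)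
  then have "d - c = b - a" unfolding *(5) using *(1,3) by simp
  moreover obtain h where "d = c + h" using *(3) le_Suc_ex by blast
  ultimately have "b = a + h" using *(1) by simp
  with * \<open>d = c + h\<close> show "I \<in> intervals \<sigma>"
    unfolding intervals_def by blast
qed

lemma intervalsI:
  assumes "distinct \<sigma>" "a \<le> b" "b < length \<sigma>" "c \<le> d" "I = (!) \<sigma> ` {a..b}" "I = {c..d}"
  shows "I \<in> intervals \<sigma>"
  unfolding intervals_iff[OF assms(1)] using assms(2-) by blast

lemma positions_of_interval:
  assumes "distinct \<sigma>" "a \<le> b" "b < length \<sigma>" "I = (!) \<sigma> ` {a..b}"
  shows "first_position \<sigma> I = a" "last_position \<sigma> I = b"
proof -
  have "{t. t < length \<sigma> \<and> \<sigma> ! t \<in> I} = {a..b}"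
    using assms by (auto simp: nth_eq_iff_index_eq)
  moreover have "Min {a..b} = a" "Max {a..b} = b"
    using assms(2) by (auto intro: Min_eqI Max_eqI)
  ultimately show "first_position \<sigma> I = a" "last_position \<sigma> I = b"
    by (simp_all only: first_position_def last_position_def)
qed

lemma interval_positions:
  assumes "distinct \<sigma>" "I \<in> intervals \<sigma>"
  shows "first_position \<sigma> I \<le> last_position \<sigma> I" "last_position \<sigma> I < length \<sigma>"
    "I = (!) \<sigma> ` {first_position \<sigma> I..last_position \<sigma> I}"
proof -
  obtain a b where ab: "a \<le> b" "b < length \<sigma>" "I = (!) \<sigma> ` {a..b}"
    using assms(2) unfolding intervals_iff[OF assms(1)] by blast
  note pos = positions_of_interval[OF assms(1) ab]
  show "first_position \<sigma> I \<le> last_position \<sigma> I" "last_position \<sigma> I < length \<sigma>"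
    "I = (!) \<sigma> ` {first_position \<sigma> I..last_position \<sigma> I}"
    unfolding pos by (fact ab)+
qed

lemma image_nth_Int:
  assumes "distinct \<sigma>" "b < length \<sigma>" "d < length \<sigma>"
  shows "(!) \<sigma> ` {a..b} \<inter> (!) \<sigma> ` {c..d} = (!) \<sigma> ` {max a c..min b d}"
  using assms by (auto simp: nth_eq_iff_index_eq)

lemma image_nth_subset_iff:
  assumes "distinct \<sigma>" "a \<le> b" "b < length \<sigma>" "d < length \<sigma>"
  shows "(!) \<sigma> ` {a..b} \<subseteq> (!) \<sigma> ` {c..d} \<longleftrightarrow> c \<le> a \<and> b \<le> d"
proof
  assume sub: "(!) \<sigma> ` {a..b} \<subseteq> (!) \<sigma> ` {c..d}"
  have "\<sigma> ! a \<in> (!) \<sigma> ` {c..d}" "\<sigma> ! b \<in> (!) \<sigma> ` {c..d}"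
    using sub assms(2) by auto
  then show "c \<le> a \<and> b \<le> d"
    using assms by (auto simp: nth_eq_iff_index_eq)
qed (auto intro!: image_mono)

lemma intervals_Int:
  assumes "distinct \<sigma>" "I \<in> intervals \<sigma>" "J \<in> intervals \<sigma>" "I \<inter> J \<noteq> {}"
  shows "I \<inter> J \<in> intervals \<sigma>"
proof -
  obtain a b c d where I: "a \<le> b" "b < length \<sigma>" "c \<le> d" "I = (!) \<sigma> ` {a..b}" "I = {c..d}"
    using assms(2) unfolding intervals_iff[OF assms(1)] by blast
  obtain a' b' c' d' where J: "a' \<le> b'" "b' < length \<sigma>" "c' \<le> d'" "J = (!) \<sigma> ` {a'..b'}" "J = {c'..d'}"
    using assms(3) unfolding intervals_iff[OF assms(1)] by blast
  have pos: "I \<inter> J = (!) \<sigma> ` {max a a'..min b b'}"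
    unfolding I(4) J(4) using assms(1) I(2) J(2) by (rule image_nth_Int)
  have val: "I \<inter> J = {max c c'..min d d'}" unfolding I(5) J(5) by auto
  obtain x where x: "x \<in> I \<inter> J" using assms(4) by blast
  have "max a a' \<le> min b b'" using x unfolding pos by auto
  moreover have "max c c' \<le> min d d'" using x unfolding val by auto
  ultimately show ?thesis
    using intervalsI[OF assms(1) _ _ _ pos val] I(2) by (simp add: min_less_iff_disj)
qed

lemma singleton_in_intervals:
  assumes "distinct \<sigma>" "v \<in> set \<sigma>"
  shows "{v} \<in> intervals \<sigma>"
proof -
  obtain i where "i < length \<sigma>" "\<sigma> ! i = v" using assms(2) by (auto simp: in_set_conv_nth)
  then show ?thesis
    unfolding intervals_iff[OF assms(1)] by (intro exI[of _ i] exI[of _ v]) auto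
qed

lemma embeds_intervals_iff:
  assumes "is_permutation \<sigma>"
  shows "embeds_family (intervals \<sigma>) (map (\<lambda>v. {v}) \<sigma>) E \<longleftrightarrow>
    E = \<lparr>nodes = intervals \<sigma>, order = inclusion_on (intervals \<sigma>),
         left = {(I, J). I \<in> intervals \<sigma> \<and> J \<in> intervals \<sigma> \<and>
           first_position \<sigma> I < first_position \<sigma> J \<and> last_position \<sigma> I < last_position \<sigma> J}\<rparr>"
proof (rule embeds_family_by_positions)
  have dist: "distinct \<sigma>" using assms by (simp add: is_permutation_def)
  note pos = interval_positions[OF dist]
  fix I assume I: "I \<in> intervals \<sigma>"
  show "first_position \<sigma> I \<le> last_position \<sigma> I \<and> last_position \<sigma> I < length (map (\<lambda>v. {v}) \<sigma>)"
    using pos[OF I] by simp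
  fix J assume J: "J \<in> intervals \<sigma>"
  show "I \<subseteq> J \<longleftrightarrow> first_position \<sigma> J \<le> first_position \<sigma> I \<and> last_position \<sigma> I \<le> last_position \<sigma> J"
    using image_nth_subset_iff[OF dist pos(1,2)[OF I] pos(2)[OF J], of "first_position \<sigma> J"]
    unfolding pos(3)[OF I, symmetric] pos(3)[OF J, symmetric] .
  assume le: "max (first_position \<sigma> I) (first_position \<sigma> J)
    \<le> min (last_position \<sigma> I) (last_position \<sigma> J)" (is "?a \<le> ?b")
  have IJ: "I \<inter> J = (!) \<sigma> ` {?a..?b}"
    using image_nth_Int[OF dist pos(2)[OF I] pos(2)[OF J], of "first_position \<sigma> I" "first_position \<sigma> J"]
    unfolding pos(3)[OF I, symmetric] pos(3)[OF J, symmetric] .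
  have "I \<inter> J \<in> intervals \<sigma>" using intervals_Int[OF dist I J] IJ le by auto
  moreover have "first_position \<sigma> (I \<inter> J) = ?a" "last_position \<sigma> (I \<inter> J) = ?b"
    using positions_of_interval[OF dist le _ IJ] pos(2)[OF I] by auto
  ultimately show "\<exists>K\<in>intervals \<sigma>. first_position \<sigma> K = ?a \<and> last_position \<sigma> K = ?b" by blast
next
  have dist: "distinct \<sigma>" using assms by (simp add: is_permutation_def)
  fix i assume i: "i < length (map (\<lambda>v. {v}) \<sigma>)"
  have "{\<sigma> ! i} = (!) \<sigma> ` {i..i}" by simp
  then show "map (\<lambda>v. {v}) \<sigma> ! i \<in> intervals \<sigma> \<and>
      first_position \<sigma> (map (\<lambda>v. {v}) \<sigma> ! i) = i \<and> last_position \<sigma> (map (\<lambda>v. {v}) \<sigma> ! i) = i"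
    using i positions_of_interval[OF dist, of i i "{\<sigma> ! i}"] singleton_in_intervals[OF dist, of "\<sigma> ! i"]
    by simp
qed

lemma ex1_embeds_intervals:
  "is_permutation \<sigma> \<Longrightarrow> \<exists>!E. embeds_family (intervals \<sigma>) (map (\<lambda>v. {v}) \<sigma>) E"
  by (simp add: embeds_intervals_iff)

lemma Ptilde_embeds:
  "is_permutation \<sigma> \<Longrightarrow> embeds_family (intervals \<sigma>) (map (\<lambda>v. {v}) \<sigma>) (Ptilde \<sigma>)"
  unfolding Ptilde_def family_embedding_def by (rule theI', rule ex1_embeds_intervals)

text \<open>The families from which \<open>Rtilde\<close> is built fall under the same lemma:\<close>

lemma intervals_decreasing: "intervals (decreasing_perm k) = argyle k"
proof -
  have dist: "distinct (increasing_perm k)" "distinct (decreasing_perm k)"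
    by (simp_all add: increasing_perm_def decreasing_perm_def)
  have len: "length (increasing_perm k) = k" "length (decreasing_perm k) = k"
    by (simp_all add: increasing_perm_def decreasing_perm_def)
  have inc: "increasing_perm k ! t = Suc t" if "t < k" for t
    using that by (simp add: increasing_perm_def del: upt_Suc)
  have dec: "decreasing_perm k ! t = k - t" if "t < k" for t
    using that by (simp add: decreasing_perm_def rev_nth len inc)
  have I: "(!) (increasing_perm k) ` {a..b} = {Suc a..Suc b}" if "b < k" for a b
  proof -
    have "(!) (increasing_perm k) ` {a..b} = Suc ` {a..b}"
      using that by (intro image_cong) (auto simp: inc)
    then show ?thesis by simp
  qed
  have D: "(!) (decreasing_perm k) ` {a..b} = {k - b..k - a}" if "a \<le> b" "b < k" for a b
  proof -
    have "(!) (decreasing_perm k) ` {a..b} = (\<lambda>t. k - t) ` {a..b}"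
      using that by (intro image_cong) (auto simp: dec)
    also have "\<dots> = {k - b..k - a}"
    proof (intro equalityI subsetI)
      fix x assume "x \<in> {k - b..k - a}"
      then have "x = k - (k - x)" "k - x \<in> {a..b}" using that by auto
      then show "x \<in> (\<lambda>t. k - t) ` {a..b}" by blast
    qed auto
    finally show ?thesis .
  qed
  have "X \<in> intervals (decreasing_perm k) \<longleftrightarrow> X \<in> argyle k" for X
  proof
    assume "X \<in> intervals (decreasing_perm k)"
    then obtain a b where ab: "a \<le> b" "b < k" and "X = (!) (decreasing_perm k) ` {a..b}"
      unfolding intervals_iff[OF dist(2)] len by blast
    then have "X = {k - b..k - a}" using D by simp
    with ab have *: "X = {Suc (k - b - 1)..Suc (k - a - 1)}" "k - b - 1 \<le> k - a - 1" "k - a - 1 < k"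
      by (auto simp: Suc_diff_Suc)
    have img: "X = (!) (increasing_perm k) ` {k - b - 1..k - a - 1}" unfolding *(1) I[OF *(3)] ..
    show "X \<in> argyle k"
      unfolding argyle_def using *(2,3)
      by (intro intervalsI[OF dist(1) _ _ _ img *(1)]) (simp_all add: len)
  next
    assume "X \<in> argyle k"
    then obtain a b where ab: "a \<le> b" "b < k" and "X = (!) (increasing_perm k) ` {a..b}"
      unfolding argyle_def intervals_iff[OF dist(1)] len by blast
    then have "X = {Suc a..Suc b}" using I by simp
    with ab have *: "X = {k - (k - a - 1)..k - (k - b - 1)}" "k - b - 1 \<le> k - a - 1" "k - a - 1 < k"
        "k - (k - a - 1) \<le> k - (k - b - 1)"
      by auto
    have img: "X = (!) (decreasing_perm k) ` {k - b - 1..k - a - 1}" unfolding *(1) D[OF *(2,3)] ..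
    show "X \<in> intervals (decreasing_perm k)"
      using *(2-4) by (intro intervalsI[OF dist(2) _ _ _ img *(1)]) (simp_all add: len)
  qed
  then show ?thesis by blast
qed

lemma Rtilde_eq_Ptilde:
  assumes "simple_permutation \<pi> \<or> \<pi> = increasing_perm (length \<pi>) \<or> \<pi> = decreasing_perm (length \<pi>)"
  shows "Rtilde \<pi> = Ptilde \<pi>"
proof (cases "simple_permutation \<pi>")
  case True
  then have "intervals \<pi> = dual_claw (length \<pi>)"
    by (simp add: simple_permutation_def dual_claw_def)
  with True show ?thesis by (simp add: Rtilde_def Ptilde_def)
next
  case False
  then have "intervals \<pi> = intervals (increasing_perm (length \<pi>)) \<or>
      intervals \<pi> = intervals (decreasing_perm (length \<pi>))"
    using assms arg_cong[of \<pi> _ intervals] by blast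
  then have "intervals \<pi> = argyle (length \<pi>)"
    by (simp only: intervals_decreasing argyle_def[symmetric] disj_absorb)
  with False show ?thesis by (simp add: Rtilde_def Ptilde_def)
qed

end

theory Submission
  imports Defs
begin

text \<open>
  The idea is to describe an interval by its first and last position.  In these coordinates the
  embedded poset \<open>Ptilde \<sigma>\<close> is explicit: the order is containment of spans, and one interval is left of
  another iff both of its end positions come earlier (\<open>span_isomorphism_Ptilde\<close>).  Any embedded poset
  that is isomorphic to the spans of \<open>\<sigma>\<close> in this sense becomes \<open>Ptilde \<sigma>\<close> once its elements are named by
  the values that they represent (\<open>represented_isomorphism_Ptilde\<close>), and so it suffices to find such an
  isomorphism for \<open>Qtilde \<sigma>\<close>, by induction along the recursive construction.

  The induction step rests on the structure of the intervals of a permutation \<open>\<sigma>\<close> with substitution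
  decomposition \<open>\<pi>[\<alpha>\<^sub>1, \<dots>, \<alpha>\<^sub>k]\<close> (\<open>inflate_span_cases\<close>): an interval lies within one block, where it is
  an interval of some \<open>\<alpha>\<^sub>i\<close>, or it is the union of the blocks of a non-singleton interval of \<open>\<pi>\<close>.  The
  danger is an interval that reaches over several blocks and uses only part of the first or the last.
  If \<open>\<pi>\<close> is monotone, the partial block would split as a sum in the direction of \<open>\<pi>\<close>, which is excluded;
  if \<open>\<pi>\<close> is simple, the interval reaches over all blocks and the letter of the partial block would be
  extremal in \<open>\<pi>\<close>, so that the remaining letters of \<open>\<pi>\<close> would form a nontrivial interval.  This matches
  \<open>replace_minimals\<close>: non-minimal elements of the poset of \<open>\<pi>\<close> stand for unions of blocks, and each
  minimal element gives way to the poset of its block (\<open>replace_minimals_span_isomorphism\<close>).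

  Finally, a substitution decomposition exists for every permutation with at least two letters
  (\<open>substitution_decomposition_exists\<close>).  A direct or skew sum is split into as many summands as
  possible; any other permutation is divided into as few interval blocks as possible, but at least two.
\<close>

section \<open>Intervals as pairs of positions\<close>

text \<open>An interval is determined by its first and last position.  The condition below compares letters
  only with each other and so does not change when values are shifted, as they are in a block of an
  inflation; \<open>in_interval_spans_iff\<close> shows that for permutations it says that the values form an
  interval.\<close>

definition interval_spans :: "nat list \<Rightarrow> (nat \<times> nat) set" where
  "interval_spans \<sigma> = {(a, b). a \<le> b \<and> b < length \<sigma> \<and>
     (\<forall>i j k. a \<le> i \<and> i \<le> b \<and> a \<le> j \<and> j \<le> b \<and> k < length \<sigma> \<and>
        \<sigma> ! i < \<sigma> ! k \<and> \<sigma> ! k < \<sigma> ! j \<longrightarrow> a \<le> k \<and> k \<le> b)}"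

lemma interval_spans_bounds:
  assumes "p \<in> interval_spans \<sigma>"
  shows "fst p \<le> snd p" "snd p < length \<sigma>"
proof -
  obtain a b where "p = (a, b)" "a \<le> b" "b < length \<sigma>"
    using assms unfolding interval_spans_def by blast
  then show "fst p \<le> snd p" "snd p < length \<sigma>" by simp_all
qed

lemma interval_spansD:
  assumes "(a, b) \<in> interval_spans \<sigma>" "a \<le> i" "i \<le> b" "a \<le> j" "j \<le> b" "k < length \<sigma>"
    "\<sigma> ! i < \<sigma> ! k" "\<sigma> ! k < \<sigma> ! j"
  shows "a \<le> k \<and> k \<le> b"
  using assms unfolding interval_spans_def by blast

lemma interval_spansI:
  assumes "a \<le> b" "b < length \<sigma>"
    and "\<And>i j k. a \<le> i \<Longrightarrow> i \<le> b \<Longrightarrow> a \<le> j \<Longrightarrow> j \<le> b \<Longrightarrow> k < length \<sigma> \<Longrightarrow>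
      \<sigma> ! i < \<sigma> ! k \<Longrightarrow> \<sigma> ! k < \<sigma> ! j \<Longrightarrow> a \<le> k \<and> k \<le> b"
  shows "(a, b) \<in> interval_spans \<sigma>"
  using assms unfolding interval_spans_def by blast

lemma singleton_in_interval_spans: "i < length \<sigma> \<Longrightarrow> (i, i) \<in> interval_spans \<sigma>"
  by (rule interval_spansI) (auto dest: less_antisym)

lemma convex_nat_set:
  fixes S :: "nat set"
  assumes "finite S" "S \<noteq> {}" "\<And>x y z. x \<in> S \<Longrightarrow> z \<in> S \<Longrightarrow> x < y \<Longrightarrow> y < z \<Longrightarrow> y \<in> S"
  shows "S = {Min S..Max S}"
proof (intro equalityI subsetI)
  fix y assume "y \<in> {Min S..Max S}"
  moreover have "Min S \<in> S" "Max S \<in> S" using assms by auto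
  ultimately show "y \<in> S" using assms(3)[of "Min S" "Max S" y] by (cases "y = Min S \<or> y = Max S") auto
qed (use assms(1) in auto)

lemma in_interval_spans_iff:
  assumes "is_permutation \<sigma>"
  shows "(a, b) \<in> interval_spans \<sigma> \<longleftrightarrow>
    a \<le> b \<and> b < length \<sigma> \<and> (\<exists>c d. c \<le> d \<and> (!) \<sigma> ` {a..b} = {c..d})"
proof -
  have dist: "distinct \<sigma>" and set: "set \<sigma> = {1..length \<sigma>}"
    using assms by (auto simp: is_permutation_def)
  show ?thesis
  proof (intro iffI conjI; (elim conjE exE)?)
    assume ab: "(a, b) \<in> interval_spans \<sigma>"
    show le: "a \<le> b" "b < length \<sigma>" using interval_spans_bounds[OF ab] by auto
    let ?S = "(!) \<sigma> ` {a..b}"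
    have "?S = {Min ?S..Max ?S}"
    proof (rule convex_nat_set)
      fix x y z assume xz: "x \<in> ?S" "z \<in> ?S" and lt: "x < y" "y < z"
      then obtain i j where ij: "i \<in> {a..b}" "j \<in> {a..b}" "x = \<sigma> ! i" "z = \<sigma> ! j" by auto
      have "x \<in> set \<sigma>" "z \<in> set \<sigma>" using ij le by auto
      then have "y \<in> set \<sigma>" using lt unfolding set by auto
      then obtain k where "k < length \<sigma>" "\<sigma> ! k = y" by (auto simp: in_set_conv_nth)
      with ij lt interval_spansD[OF ab, of i j k] show "y \<in> ?S" by auto
    qed (use le in auto)
    moreover have "Min ?S \<le> Max ?S" using le by (intro Min_le_iff[THEN iffD2]) (auto intro!: bexI[of _ a])
    ultimately show "\<exists>c d. c \<le> d \<and> ?S = {c..d}" by blast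
  next
    fix c d assume le: "a \<le> b" "b < length \<sigma>" and cd: "c \<le> d" "(!) \<sigma> ` {a..b} = {c..d}"
    show "(a, b) \<in> interval_spans \<sigma>"
    proof (rule interval_spansI[OF le])
      fix i j k assume ij: "a \<le> i" "i \<le> b" "a \<le> j" "j \<le> b" and k: "k < length \<sigma>"
        and lt: "\<sigma> ! i < \<sigma> ! k" "\<sigma> ! k < \<sigma> ! j"
      have "\<sigma> ! i \<in> {c..d}" "\<sigma> ! j \<in> {c..d}" using ij unfolding cd(2)[symmetric] by auto
      then have "\<sigma> ! k \<in> (!) \<sigma> ` {a..b}" using lt unfolding cd(2) by auto
      then show "a \<le> k \<and> k \<le> b" using k le dist by (auto simp: nth_eq_iff_index_eq)
    qed
  qed
qed

lemma intervals_eq_spans: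
  assumes "is_permutation \<sigma>"
  shows "intervals \<sigma> = (\<lambda>(a, b). (!) \<sigma> ` {a..b}) ` interval_spans \<sigma>"
proof -
  have dist: "distinct \<sigma>" using assms by (simp add: is_permutation_def)
  show ?thesis
  proof (intro equalityI subsetI)
    fix I assume "I \<in> intervals \<sigma>"
    then obtain a b c d where "a \<le> b" "b < length \<sigma>" "c \<le> d" and I: "I = (!) \<sigma> ` {a..b}" and "I = {c..d}"
      unfolding intervals_iff[OF dist] by blast
    then have "(a, b) \<in> interval_spans \<sigma>"
      unfolding in_interval_spans_iff[OF assms] by blast
    then show "I \<in> (\<lambda>(a, b). (!) \<sigma> ` {a..b}) ` interval_spans \<sigma>"
      using I by (intro image_eqI[of _ _ "(a, b)"]) simp_all
  next
    fix I assume "I \<in> (\<lambda>(a, b). (!) \<sigma> ` {a..b}) ` interval_spans \<sigma>"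
    then obtain a b where ab: "(a, b) \<in> interval_spans \<sigma>" and I: "I = (!) \<sigma> ` {a..b}" by auto
    show "I \<in> intervals \<sigma>"
      using ab unfolding in_interval_spans_iff[OF assms] intervals_iff[OF dist] I by blast
  qed
qed

text \<open>In terms of end positions, both the order and the left-to-right relation of an embedding of the
  intervals are explicit: \<open>I\<close> is below \<open>J\<close> iff its end positions lie between those of \<open>J\<close>, and left of
  \<open>J\<close> iff both of its end positions come earlier.  So there is a single target, the set of spans of
  \<open>\<sigma>\<close>, with which all embedded posets are compared.\<close>

definition span_isomorphism :: "nat list \<Rightarrow> 'a embedded_poset \<Rightarrow> ('a \<Rightarrow> nat \<times> nat) \<Rightarrow> bool" where
  "span_isomorphism \<sigma> E f \<longleftrightarrow>
     bij_betw f (nodes E) (interval_spans \<sigma>) \<and>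
     order E = {(x, y). x \<in> nodes E \<and> y \<in> nodes E \<and> fst (f y) \<le> fst (f x) \<and> snd (f x) \<le> snd (f y)} \<and>
     left E = {(x, y). x \<in> nodes E \<and> y \<in> nodes E \<and> fst (f x) < fst (f y) \<and> snd (f x) < snd (f y)}"

lemma span_isomorphism_Ptilde:
  assumes "is_permutation \<sigma>"
  shows "span_isomorphism \<sigma> (Ptilde \<sigma>) (\<lambda>I. (first_position \<sigma> I, last_position \<sigma> I))"
proof -
  have dist: "distinct \<sigma>" using assms by (simp add: is_permutation_def)
  note P = Ptilde_embeds[OF assms, unfolded embeds_intervals_iff[OF assms]]
  note pos = interval_positions[OF dist]
  have sub: "I \<subseteq> J \<longleftrightarrow> first_position \<sigma> J \<le> first_position \<sigma> I \<and> last_position \<sigma> I \<le> last_position \<sigma> J"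
    if I: "I \<in> intervals \<sigma>" and J: "J \<in> intervals \<sigma>" for I J
    using image_nth_subset_iff[OF dist pos(1,2)[OF I] pos(2)[OF J], of "first_position \<sigma> J"]
    unfolding pos(3)[OF I, symmetric] pos(3)[OF J, symmetric] .
  have posI: "first_position \<sigma> ((!) \<sigma> ` {a..b}) = a" "last_position \<sigma> ((!) \<sigma> ` {a..b}) = b"
    if "(a, b) \<in> interval_spans \<sigma>" for a b
    using positions_of_interval[OF dist _ _ refl, of a b] interval_spans_bounds[OF that] by auto
  have "bij_betw (\<lambda>I. (first_position \<sigma> I, last_position \<sigma> I)) (intervals \<sigma>) (interval_spans \<sigma>)"
    by (rule bij_betwI[where g = "\<lambda>(a, b). (!) \<sigma> ` {a..b}"])
       (auto simp: intervals_eq_spans[OF assms] posI)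
  moreover have "inclusion_on (intervals \<sigma>) = {(I, J). I \<in> intervals \<sigma> \<and> J \<in> intervals \<sigma> \<and>
      first_position \<sigma> J \<le> first_position \<sigma> I \<and> last_position \<sigma> I \<le> last_position \<sigma> J}"
    using sub unfolding inclusion_on_def by blast
  ultimately show ?thesis
    unfolding span_isomorphism_def P by simp
qed

context
  fixes \<sigma> :: "nat list" and E :: "'a embedded_poset" and f :: "'a \<Rightarrow> nat \<times> nat"
  assumes iso: "span_isomorphism \<sigma> E f"
begin

lemma span_isomorphism_bij: "bij_betw f (nodes E) (interval_spans \<sigma>)"
  using iso by (simp add: span_isomorphism_def)

lemma span_isomorphism_order:
  "(x, y) \<in> order E \<longleftrightarrow>
    x \<in> nodes E \<and> y \<in> nodes E \<and> fst (f y) \<le> fst (f x) \<and> snd (f x) \<le> snd (f y)"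
  using iso by (simp add: span_isomorphism_def)

lemma span_isomorphism_left:
  "(x, y) \<in> left E \<longleftrightarrow>
    x \<in> nodes E \<and> y \<in> nodes E \<and> fst (f x) < fst (f y) \<and> snd (f x) < snd (f y)"
  using iso by (simp add: span_isomorphism_def)

lemma span_isomorphism_node:
  assumes "p \<in> interval_spans \<sigma>"
  obtains x where "x \<in> nodes E" "f x = p"
  using assms span_isomorphism_bij unfolding bij_betw_def by (metis imageE)

lemma span_isomorphism_bounds:
  assumes "x \<in> nodes E"
  shows "f x \<in> interval_spans \<sigma>" "fst (f x) \<le> snd (f x)" "snd (f x) < length \<sigma>"
proof -
  show "f x \<in> interval_spans \<sigma>" using span_isomorphism_bij assms by (rule bij_betwE[rule_format])
  then show "fst (f x) \<le> snd (f x)" "snd (f x) < length \<sigma>" by (fact interval_spans_bounds)+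
qed

lemma span_isomorphism_inj: "x \<in> nodes E \<Longrightarrow> y \<in> nodes E \<Longrightarrow> f x = f y \<longleftrightarrow> x = y"
  using span_isomorphism_bij by (auto simp: bij_betw_def inj_on_def)

text \<open>Every single position is a span and lies below each span that contains it, so nothing else can be
  minimal.\<close>

lemma minimals_span_isomorphism: "minimals E = {m \<in> nodes E. fst (f m) = snd (f m)}"
proof (intro set_eqI iffI)
  fix m assume m: "m \<in> minimals E"
  then have mE: "m \<in> nodes E" by (simp add: minimals_def)
  note b = span_isomorphism_bounds[OF mE]
  have "(fst (f m), fst (f m)) \<in> interval_spans \<sigma>"
    using b by (intro singleton_in_interval_spans) simp
  then obtain x where x: "x \<in> nodes E" "f x = (fst (f m), fst (f m))" by (rule span_isomorphism_node)
  then have "(x, m) \<in> order E" using b mE by (simp add: span_isomorphism_order)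
  then have "x = m" using m x by (simp add: minimals_def)
  then have "snd (f m) = fst (f m)" using x by (metis snd_conv)
  then show "m \<in> {m \<in> nodes E. fst (f m) = snd (f m)}" using mE by simp
next
  fix m assume m: "m \<in> {m \<in> nodes E. fst (f m) = snd (f m)}"
  have "x = m" if "x \<in> nodes E" "(x, m) \<in> order E" for x
  proof -
    have "f x = f m"
      using that m span_isomorphism_bounds[OF that(1)]
      by (auto simp: span_isomorphism_order prod_eq_iff)
    then show ?thesis using that m span_isomorphism_inj by auto
  qed
  then show "m \<in> minimals E" using m by (auto simp: minimals_def)
qed

lemma min_rank_span_isomorphism:
  assumes "m \<in> minimals E"
  shows "min_rank E m = fst (f m)"
proof -
  have m: "m \<in> nodes E" "fst (f m) = snd (f m)" using assms by (auto simp: minimals_span_isomorphism)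
  let ?A = "{x \<in> minimals E. (x, m) \<in> left E}"
  have A: "?A = {x \<in> nodes E. fst (f x) = snd (f x) \<and> fst (f x) < fst (f m)}"
    using m by (auto simp: minimals_span_isomorphism span_isomorphism_left)
  have "bij_betw (fst \<circ> f) ?A {..<fst (f m)}"
    unfolding bij_betw_def A
  proof (intro conjI equalityI subsetI)
    show "inj_on (fst \<circ> f) {x \<in> nodes E. fst (f x) = snd (f x) \<and> fst (f x) < fst (f m)}"
      by (rule inj_onI) (auto simp: span_isomorphism_inj[symmetric] prod_eq_iff)
    fix i assume "i \<in> {..<fst (f m)}"
    then have i: "i < fst (f m)" "(i, i) \<in> interval_spans \<sigma>"
      using span_isomorphism_bounds[OF m(1)] by (auto intro!: singleton_in_interval_spans)
    obtain x where "x \<in> nodes E" "f x = (i, i)" using span_isomorphism_node[OF i(2)] .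
    then show "i \<in> (fst \<circ> f) ` {x \<in> nodes E. fst (f x) = snd (f x) \<and> fst (f x) < fst (f m)}"
      using i by (auto intro!: image_eqI[of _ _ x])
  qed auto
  then show ?thesis unfolding min_rank_def by (simp add: bij_betw_same_card)
qed

text \<open>The minimal elements below \<open>x\<close> sit at the positions of the span of \<open>x\<close>, and by
  \<open>min_rank_span_isomorphism\<close> the position of a minimal element is its rank.\<close>

lemma represented_span_isomorphism:
  assumes "x \<in> nodes E"
  shows "represented \<sigma> E x = (!) \<sigma> ` {fst (f x)..snd (f x)}"
proof (intro equalityI subsetI)
  fix v assume "v \<in> represented \<sigma> E x"
  then obtain m where "v = \<sigma> ! min_rank E m" "m \<in> minimals E" "(m, x) \<in> order E"
    by (auto simp: represented_def)
  then show "v \<in> (!) \<sigma> ` {fst (f x)..snd (f x)}"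
    using min_rank_span_isomorphism[of m] by (auto simp: span_isomorphism_order minimals_span_isomorphism)
next
  fix v assume "v \<in> (!) \<sigma> ` {fst (f x)..snd (f x)}"
  then obtain i where i: "fst (f x) \<le> i" "i \<le> snd (f x)" "v = \<sigma> ! i" by auto
  then have "(i, i) \<in> interval_spans \<sigma>"
    using span_isomorphism_bounds[OF assms] by (auto intro!: singleton_in_interval_spans)
  then obtain m where m: "m \<in> nodes E" "f m = (i, i)" by (rule span_isomorphism_node)
  then have "m \<in> minimals E" "(m, x) \<in> order E"
    using i assms by (auto simp: minimals_span_isomorphism span_isomorphism_order)
  then show "v \<in> represented \<sigma> E x"
    using min_rank_span_isomorphism[of m] i m by (auto simp: represented_def)
qed

end

lemma rename_eq_by_spans:
  assumes E: "span_isomorphism \<sigma> E f" and F: "span_isomorphism \<sigma> F g"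
    and h: "\<And>x. x \<in> nodes E \<Longrightarrow> h x \<in> nodes F \<and> g (h x) = f x"
  shows "inj_on h (nodes E) \<and> rename h E = F"
proof
  show "inj_on h (nodes E)"
    by (rule inj_onI) (metis h span_isomorphism_inj[OF E])
  have surj: "\<exists>x\<in>nodes E. y = h x" if y: "y \<in> nodes F" for y
  proof -
    obtain x where "x \<in> nodes E" "f x = g y"
      using span_isomorphism_bounds(1)[OF F y] by (rule span_isomorphism_node[OF E])
    then show ?thesis using h[of x] y span_isomorphism_inj[OF F] by metis
  qed
  have "h ` nodes E = nodes F" using h surj by auto
  moreover have "map_prod h h ` order E = order F"
  proof (intro equalityI subrelI)
    fix u v assume "(u, v) \<in> order F"
    moreover from this obtain x y where "x \<in> nodes E" "u = h x" "y \<in> nodes E" "v = h y"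
      using surj unfolding span_isomorphism_order[OF F] by blast
    ultimately show "(u, v) \<in> map_prod h h ` order E"
      using h
      by (intro image_eqI[of _ _ "(x, y)"]) (auto simp: span_isomorphism_order[OF E] span_isomorphism_order[OF F])
  qed (use h in \<open>auto simp: span_isomorphism_order[OF E] span_isomorphism_order[OF F]\<close>)
  moreover have "map_prod h h ` left E = left F"
  proof (intro equalityI subrelI)
    fix u v assume "(u, v) \<in> left F"
    moreover from this obtain x y where "x \<in> nodes E" "u = h x" "y \<in> nodes E" "v = h y"
      using surj unfolding span_isomorphism_left[OF F] by blast
    ultimately show "(u, v) \<in> map_prod h h ` left E"
      using h
      by (intro image_eqI[of _ _ "(x, y)"]) (auto simp: span_isomorphism_left[OF E] span_isomorphism_left[OF F])
  qed (use h in \<open>auto simp: span_isomorphism_left[OF E] span_isomorphism_left[OF F]\<close>)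
  ultimately show "rename h E = F" by (simp add: rename_def)
qed

text \<open>An isomorphism onto the spans forces the naming of elements by the values that they represent, so
  it is enough to find some isomorphism.\<close>

lemma represented_isomorphism_Ptilde:
  assumes perm: "is_permutation \<sigma>" and E: "span_isomorphism \<sigma> E f"
  shows "inj_on (represented \<sigma> E) (nodes E) \<and> rename (represented \<sigma> E) E = Ptilde \<sigma>"
proof (rule rename_eq_by_spans[OF E span_isomorphism_Ptilde[OF perm]])
  have dist: "distinct \<sigma>" using perm by (simp add: is_permutation_def)
  have nodes: "nodes (Ptilde \<sigma>) = intervals \<sigma>"
    using Ptilde_embeds[OF perm] by (simp add: embeds_family_def)
  fix x assume x: "x \<in> nodes E"
  note b = span_isomorphism_bounds[OF E x] and r = represented_span_isomorphism[OF E x]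
  have "represented \<sigma> E x \<in> intervals \<sigma>"
    using b(1) unfolding r intervals_eq_spans[OF perm] by (intro image_eqI[of _ _ "f x"]) auto
  then show "represented \<sigma> E x \<in> nodes (Ptilde \<sigma>) \<and>
      (first_position \<sigma> (represented \<sigma> E x), last_position \<sigma> (represented \<sigma> E x)) = f x"
    using positions_of_interval[OF dist b(2,3) r] by (simp add: nodes)
qed

section \<open>Positions and values in an inflation\<close>

definition block_start :: "'a list list \<Rightarrow> nat \<Rightarrow> nat" where
  "block_start bs i = (\<Sum>j<i. length (bs ! j))"

lemma block_start_Suc: "block_start bs (Suc i) = block_start bs i + length (bs ! i)"
  by (simp add: block_start_def)

lemma block_start_mono: "i \<le> j \<Longrightarrow> block_start bs i \<le> block_start bs j"
  unfolding block_start_def by (intro sum_mono2) auto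

lemma block_start_add_le:
  assumes "i < j"
  shows "block_start bs i + length (bs ! i) \<le> block_start bs j"
  using block_start_mono[of "Suc i" j bs] assms by (simp add: block_start_Suc)

lemma block_index_mono:
  assumes "block_start bs i + x \<le> block_start bs j + y" "y < length (bs ! j)"
  shows "i \<le> j"
  using assms block_start_add_le[of j i bs] by linarith

lemma block_position_eq_iff:
  assumes "x < length (bs ! i)" "y < length (bs ! j)"
  shows "block_start bs i + x = block_start bs j + y \<longleftrightarrow> i = j \<and> x = y"
  using block_index_mono[of bs i x j y] block_index_mono[of bs j y i x] assms by auto

lemma block_position_cases:
  assumes "p < block_start bs k"
  obtains i x where "i < k" "x < length (bs ! i)" "p = block_start bs i + x"
  using assms
proof (induction k arbitrary: thesis)
  case (Suc k)
  show ?case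
  proof (cases "p < block_start bs k")
    case True
    then obtain i x where "i < k" "x < length (bs ! i)" "p = block_start bs i + x"
      using Suc.IH by blast
    then show ?thesis using Suc.prems(1)[of i x] by simp
  next
    case False
    then show ?thesis
      using Suc.prems(1)[of k "p - block_start bs k"] Suc.prems(2) by (simp add: block_start_Suc)
  qed
qed (simp add: block_start_def)

lemma length_concat_block_start: "length (concat bs) = block_start bs (length bs)"
  by (simp add: length_concat block_start_def sum_list_sum_nth atLeast0LessThan)

lemma nth_concat_block:
  assumes "i < length bs" "x < length (bs ! i)"
  shows "concat bs ! (block_start bs i + x) = bs ! i ! x"
proof -
  have "concat bs = concat (take i bs) @ bs ! i @ concat (drop (Suc i) bs)"
    using id_take_nth_drop[OF assms(1)] by (metis append.simps concat.simps(2) concat_append)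
  moreover have "length (concat (take i bs)) = block_start bs i"
    using assms(1) by (simp add: length_concat_block_start block_start_def)
  ultimately show ?thesis using assms(2) by (simp add: nth_append)
qed

definition block_shift :: "nat list \<Rightarrow> nat list list \<Rightarrow> nat \<Rightarrow> nat" where
  "block_shift \<pi> \<alpha>s i = (\<Sum>j | j < length \<pi> \<and> \<pi> ! j < \<pi> ! i. length (\<alpha>s ! j))"

text \<open>With \<open>R\<close> being \<open>(<)\<close> or \<open>(>)\<close>, a cut is a place where the word splits into two parts that form a
  direct or a skew sum.\<close>

definition cut :: "(nat \<Rightarrow> nat \<Rightarrow> bool) \<Rightarrow> nat list \<Rightarrow> nat \<Rightarrow> bool" where
  "cut R \<alpha> x \<longleftrightarrow> 0 < x \<and> x < length \<alpha> \<and> (\<forall>y<x. \<forall>z. x \<le> z \<and> z < length \<alpha> \<longrightarrow> R (\<alpha> ! y) (\<alpha> ! z))"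

text \<open>What a substitution decomposition contributes to the description of the intervals, in terms of
  positions: either the outer permutation has only trivial intervals, or it is monotone and no block
  has a cut in the same direction.\<close>

definition tight_inflation :: "nat list \<Rightarrow> nat list list \<Rightarrow> bool" where
  "tight_inflation \<pi> \<alpha>s \<longleftrightarrow>
     (4 \<le> length \<pi> \<and> (\<forall>a b. (a, b) \<in> interval_spans \<pi> \<longrightarrow> a = b \<or> a = 0 \<and> Suc b = length \<pi>)) \<or>
     (sorted_wrt (<) \<pi> \<and> (\<forall>\<alpha>\<in>set \<alpha>s. \<forall>x. \<not> cut (<) \<alpha> x)) \<or>
     (sorted_wrt (>) \<pi> \<and> (\<forall>\<alpha>\<in>set \<alpha>s. \<forall>x. \<not> cut (>) \<alpha> x))"

context
  fixes \<pi> :: "nat list" and \<alpha>s :: "nat list list"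
  assumes dist: "distinct \<pi>" and len: "length \<alpha>s = length \<pi>"
    and perms: "\<forall>\<alpha>\<in>set \<alpha>s. is_permutation \<alpha>"
begin

lemma nonempty_block: "i < length \<pi> \<Longrightarrow> 0 < length (\<alpha>s ! i)"
  using bspec[OF perms, of "\<alpha>s ! i"] len by (auto simp: is_permutation_def)

lemma distinct_block: "i < length \<pi> \<Longrightarrow> distinct (\<alpha>s ! i)"
  using bspec[OF perms, of "\<alpha>s ! i"] len by (auto simp: is_permutation_def)

lemma block_value_bounds:
  assumes "i < length \<pi>" "x < length (\<alpha>s ! i)"
  shows "0 < \<alpha>s ! i ! x" "\<alpha>s ! i ! x \<le> length (\<alpha>s ! i)"
proof -
  have "is_permutation (\<alpha>s ! i)" using perms assms(1) len by simp
  then have "\<alpha>s ! i ! x \<in> {1..length (\<alpha>s ! i)}"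
    using assms(2) nth_mem unfolding is_permutation_def by metis
  then show "0 < \<alpha>s ! i ! x" "\<alpha>s ! i ! x \<le> length (\<alpha>s ! i)" by auto
qed

lemma length_inflate_block_start: "length (inflate \<pi> \<alpha>s) = block_start \<alpha>s (length \<pi>)"
  using length_inflate[OF len] by (simp add: block_start_def)

lemma block_position_less:
  assumes "i < length \<pi>" "x < length (\<alpha>s ! i)"
  shows "block_start \<alpha>s i + x < length (inflate \<pi> \<alpha>s)"
  using assms block_start_add_le[OF assms(1), of \<alpha>s] by (simp add: length_inflate_block_start)

lemma nth_inflate:
  assumes i: "i < length \<pi>" and x: "x < length (\<alpha>s ! i)"
  shows "inflate \<pi> \<alpha>s ! (block_start \<alpha>s i + x) = \<alpha>s ! i ! x + block_shift \<pi> \<alpha>s i"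
proof -
  let ?bs = "map (\<lambda>i. map (\<lambda>v. v + block_shift \<pi> \<alpha>s i) (\<alpha>s ! i)) [0..<length \<pi>]"
  have "block_start ?bs i = block_start \<alpha>s i"
    unfolding block_start_def using i by (intro sum.cong) auto
  then show ?thesis
    using nth_concat_block[of i ?bs x] i x by (simp add: inflate_def block_shift_def)
qed

lemma block_shift_add_le:
  assumes "i < length \<pi>" "j < length \<pi>" "\<pi> ! i < \<pi> ! j"
  shows "block_shift \<pi> \<alpha>s i + length (\<alpha>s ! i) \<le> block_shift \<pi> \<alpha>s j"
proof -
  have "block_shift \<pi> \<alpha>s i + length (\<alpha>s ! i) =
      (\<Sum>t\<in>insert i {t. t < length \<pi> \<and> \<pi> ! t < \<pi> ! i}. length (\<alpha>s ! t))"
    by (simp add: block_shift_def)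
  also have "\<dots> \<le> block_shift \<pi> \<alpha>s j"
    unfolding block_shift_def using assms by (intro sum_mono2) auto
  finally show ?thesis .
qed

text \<open>The shifts put the values of different blocks into disjoint ranges, which are ordered as in \<open>\<pi>\<close>.\<close>

lemma inflate_less_blockwise:
  assumes i: "i < length \<pi>" "x < length (\<alpha>s ! i)" and j: "j < length \<pi>" "y < length (\<alpha>s ! j)"
  shows "inflate \<pi> \<alpha>s ! (block_start \<alpha>s i + x) < inflate \<pi> \<alpha>s ! (block_start \<alpha>s j + y) \<longleftrightarrow>
    (if i = j then \<alpha>s ! i ! x < \<alpha>s ! j ! y else \<pi> ! i < \<pi> ! j)"
proof -
  consider "i = j" | "i \<noteq> j" "\<pi> ! i < \<pi> ! j" | "i \<noteq> j" "\<pi> ! j < \<pi> ! i"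
    using dist i(1) j(1) by (metis nat_neq_iff nth_eq_iff_index_eq)
  then show ?thesis
    unfolding nth_inflate[OF i] nth_inflate[OF j]
    using block_value_bounds[OF i] block_value_bounds[OF j]
      block_shift_add_le[OF i(1) j(1)] block_shift_add_le[OF j(1) i(1)]
    by cases auto
qed

section \<open>Intervals of an inflation\<close>

lemma inflate_span_of_outer_span:
  assumes uv: "(u, v) \<in> interval_spans \<pi>"
  shows "(block_start \<alpha>s u, block_start \<alpha>s (Suc v) - 1) \<in> interval_spans (inflate \<pi> \<alpha>s)"
proof -
  have u: "u \<le> v" "v < length \<pi>" using interval_spans_bounds[OF uv] by auto
  note v0 = nonempty_block[OF u(2)]
  have mem: "block_start \<alpha>s u \<le> block_start \<alpha>s i + x \<and> block_start \<alpha>s i + x \<le> block_start \<alpha>s (Suc v) - 1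
      \<longleftrightarrow> u \<le> i \<and> i \<le> v" if "x < length (\<alpha>s ! i)" for i x
    using that v0 block_index_mono[of \<alpha>s u 0 i x] block_index_mono[of \<alpha>s i x v "length (\<alpha>s ! v) - 1"]
      block_start_mono[of u i \<alpha>s] block_start_mono[of "Suc i" "Suc v" \<alpha>s]
    by (auto simp: block_start_Suc)
  have "block_start \<alpha>s u \<le> block_start \<alpha>s (Suc v) - 1"
    using mem[of 0 u] nonempty_block[of u] u by auto
  moreover have "block_start \<alpha>s (Suc v) - 1 < length (inflate \<pi> \<alpha>s)"
    using block_position_less[OF u(2), of "length (\<alpha>s ! v) - 1"] v0 by (simp add: block_start_Suc)
  ultimately show ?thesis
  proof (rule interval_spansI)
    fix p q r
    assume p: "block_start \<alpha>s u \<le> p" "p \<le> block_start \<alpha>s (Suc v) - 1"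
      and q: "block_start \<alpha>s u \<le> q" "q \<le> block_start \<alpha>s (Suc v) - 1"
      and r: "r < length (inflate \<pi> \<alpha>s)"
      and lt: "inflate \<pi> \<alpha>s ! p < inflate \<pi> \<alpha>s ! r" "inflate \<pi> \<alpha>s ! r < inflate \<pi> \<alpha>s ! q"
    have "block_start \<alpha>s (Suc v) - 1 < block_start \<alpha>s (length \<pi>)"
      using \<open>block_start \<alpha>s (Suc v) - 1 < length (inflate \<pi> \<alpha>s)\<close> by (simp add: length_inflate_block_start)
    then have "p < block_start \<alpha>s (length \<pi>)" "q < block_start \<alpha>s (length \<pi>)"
        "r < block_start \<alpha>s (length \<pi>)"
      using p q r by (auto simp: length_inflate_block_start)
    then obtain i x j y k z where
      i: "i < length \<pi>" "x < length (\<alpha>s ! i)" "p = block_start \<alpha>s i + x" and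
      j: "j < length \<pi>" "y < length (\<alpha>s ! j)" "q = block_start \<alpha>s j + y" and
      k: "k < length \<pi>" "z < length (\<alpha>s ! k)" "r = block_start \<alpha>s k + z"
      by (meson block_position_cases)
    have ij: "u \<le> i \<and> i \<le> v" "u \<le> j \<and> j \<le> v" using p q mem i j by auto
    have "u \<le> k \<and> k \<le> v"
    proof (cases "k = i \<or> k = j")
      case False
      then have "\<pi> ! i < \<pi> ! k" "\<pi> ! k < \<pi> ! j"
        using lt inflate_less_blockwise[OF i(1,2) k(1,2)] inflate_less_blockwise[OF k(1,2) j(1,2)]
        unfolding i(3) j(3) k(3) by auto
      then show ?thesis using interval_spansD[OF uv] ij k(1) by blast
    qed (use ij in auto)
    then show "block_start \<alpha>s u \<le> r \<and> r \<le> block_start \<alpha>s (Suc v) - 1" using mem k by auto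
  qed
qed

lemma inflate_span_of_block_span:
  assumes i: "i < length \<pi>" and xy: "(x, y) \<in> interval_spans (\<alpha>s ! i)"
  shows "(block_start \<alpha>s i + x, block_start \<alpha>s i + y) \<in> interval_spans (inflate \<pi> \<alpha>s)"
proof -
  have x: "x \<le> y" "y < length (\<alpha>s ! i)" using interval_spans_bounds[OF xy] by auto
  show ?thesis
  proof (rule interval_spansI)
    fix p q r
    assume p: "block_start \<alpha>s i + x \<le> p" "p \<le> block_start \<alpha>s i + y"
      and q: "block_start \<alpha>s i + x \<le> q" "q \<le> block_start \<alpha>s i + y"
      and r: "r < length (inflate \<pi> \<alpha>s)"
      and lt: "inflate \<pi> \<alpha>s ! p < inflate \<pi> \<alpha>s ! r" "inflate \<pi> \<alpha>s ! r < inflate \<pi> \<alpha>s ! q"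
    obtain k z where k: "k < length \<pi>" "z < length (\<alpha>s ! k)" "r = block_start \<alpha>s k + z"
      using r unfolding length_inflate_block_start by (meson block_position_cases)
    define p' q' where "p' = p - block_start \<alpha>s i" and "q' = q - block_start \<alpha>s i"
    have p': "p = block_start \<alpha>s i + p'" "x \<le> p'" "p' \<le> y" "p' < length (\<alpha>s ! i)"
      and q': "q = block_start \<alpha>s i + q'" "x \<le> q'" "q' \<le> y" "q' < length (\<alpha>s ! i)"
      using p q x by (auto simp: p'_def q'_def)
    note less = inflate_less_blockwise[OF i p'(4) k(1,2)] inflate_less_blockwise[OF k(1,2) i q'(4)]
    have "k = i" using lt less unfolding p'(1) q'(1) k(3) by (cases "k = i") auto
    then have "\<alpha>s ! i ! p' < \<alpha>s ! i ! z" "\<alpha>s ! i ! z < \<alpha>s ! i ! q'"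
      using lt less unfolding p'(1) q'(1) k(3) by auto
    then have "x \<le> z \<and> z \<le> y" using interval_spansD[OF xy] p' q' k(2) \<open>k = i\<close> by blast
    then show "block_start \<alpha>s i + x \<le> r \<and> r \<le> block_start \<alpha>s i + y" using k \<open>k = i\<close> by simp
  qed (use x i block_position_less in auto)
qed

lemma block_span_of_inflate_span:
  assumes i: "i < length \<pi>" and xy: "x \<le> y" "y < length (\<alpha>s ! i)"
    and span: "(block_start \<alpha>s i + x, block_start \<alpha>s i + y) \<in> interval_spans (inflate \<pi> \<alpha>s)"
  shows "(x, y) \<in> interval_spans (\<alpha>s ! i)"
proof (rule interval_spansI[OF xy])
  fix p q r
  assume *: "x \<le> p" "p \<le> y" "x \<le> q" "q \<le> y" "r < length (\<alpha>s ! i)"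
    and lt: "\<alpha>s ! i ! p < \<alpha>s ! i ! r" "\<alpha>s ! i ! r < \<alpha>s ! i ! q"
  have "p < length (\<alpha>s ! i)" "q < length (\<alpha>s ! i)" using * xy by auto
  then show "x \<le> r \<and> r \<le> y"
    using interval_spansD[OF span, of "block_start \<alpha>s i + p" "block_start \<alpha>s i + q" "block_start \<alpha>s i + r"]
      lt * i block_position_less[OF i, of r] by (simp add: inflate_less_blockwise)
qed

text \<open>The other intervals of an inflation straddle several blocks: they start at offset \<open>x\<close> in block \<open>i\<close>
  and end at offset \<open>y\<close> in a later block \<open>j\<close>.  It remains to see that they consist of whole blocks.\<close>

context
  fixes i j x y :: nat
  assumes ij: "i < j" "j < length \<pi>" and x: "x < length (\<alpha>s ! i)" and y: "y < length (\<alpha>s ! j)"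
    and span: "(block_start \<alpha>s i + x, block_start \<alpha>s j + y) \<in> interval_spans (inflate \<pi> \<alpha>s)"
begin

lemma straddling_left_block_less: "i < length \<pi>"
  using ij by simp

lemma straddling_spanD:
  assumes "a < length \<pi>" "s < length (\<alpha>s ! a)" "b < length \<pi>" "t < length (\<alpha>s ! b)"
    "c < length \<pi>" "r < length (\<alpha>s ! c)"
    "block_start \<alpha>s i + x \<le> block_start \<alpha>s a + s" "block_start \<alpha>s a + s \<le> block_start \<alpha>s j + y"
    "block_start \<alpha>s i + x \<le> block_start \<alpha>s b + t" "block_start \<alpha>s b + t \<le> block_start \<alpha>s j + y"
    "if a = c then \<alpha>s ! a ! s < \<alpha>s ! c ! r else \<pi> ! a < \<pi> ! c"
    "if c = b then \<alpha>s ! c ! r < \<alpha>s ! b ! t else \<pi> ! c < \<pi> ! b"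
  shows "block_start \<alpha>s i + x \<le> block_start \<alpha>s c + r \<and> block_start \<alpha>s c + r \<le> block_start \<alpha>s j + y"
  using assms block_position_less[of c r] inflate_less_blockwise[of a s c r]
    inflate_less_blockwise[of c r b t]
    interval_spansD[OF span, of "block_start \<alpha>s a + s" "block_start \<alpha>s b + t" "block_start \<alpha>s c + r"]
  by blast

lemma straddling_span_first_inside: "i < w \<Longrightarrow> w \<le> j \<Longrightarrow>
    block_start \<alpha>s i + x \<le> block_start \<alpha>s w \<and> block_start \<alpha>s w \<le> block_start \<alpha>s j + y"
  using block_start_add_le[of i w \<alpha>s] block_start_mono[of w j \<alpha>s] x by linarith

lemma straddling_span_last_inside: "i \<le> w \<Longrightarrow> w < j \<Longrightarrow>
    block_start \<alpha>s i + x \<le> block_start \<alpha>s w + (length (\<alpha>s ! w) - 1) \<and>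
    block_start \<alpha>s w + (length (\<alpha>s ! w) - 1) \<le> block_start \<alpha>s j + y"
  using block_start_add_le[of w j \<alpha>s] block_start_add_le[of i w \<alpha>s] x
    nonempty_block[of w] ij by (cases "i = w") auto

lemma outer_span_of_straddling_span: "(i, j) \<in> interval_spans \<pi>"
proof (rule interval_spansI)
  fix u v w
  assume uv: "i \<le> u" "u \<le> j" "i \<le> v" "v \<le> j" and w: "w < length \<pi>"
    and lt: "\<pi> ! u < \<pi> ! w" "\<pi> ! w < \<pi> ! v"
  have ex: "\<exists>s<length (\<alpha>s ! t). block_start \<alpha>s i + x \<le> block_start \<alpha>s t + s \<and>
      block_start \<alpha>s t + s \<le> block_start \<alpha>s j + y" if t: "i \<le> t" "t \<le> j" for t
  proof (cases "t = j")
    case True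
    then show ?thesis using straddling_span_first_inside[of j] ij y by (intro exI[of _ y]) auto
  next
    case False
    then show ?thesis using straddling_span_last_inside[of t] t nonempty_block[of t] ij
      by (intro exI[of _ "length (\<alpha>s ! t) - 1"]) auto
  qed
  obtain s where s: "s < length (\<alpha>s ! u)" "block_start \<alpha>s i + x \<le> block_start \<alpha>s u + s"
      "block_start \<alpha>s u + s \<le> block_start \<alpha>s j + y"
    using ex uv(1,2) by blast
  obtain t where t: "t < length (\<alpha>s ! v)" "block_start \<alpha>s i + x \<le> block_start \<alpha>s v + t"
      "block_start \<alpha>s v + t \<le> block_start \<alpha>s j + y"
    using ex uv(3,4) by blast
  have ne: "u \<noteq> w" "w \<noteq> v" using lt by auto
  have w0: "0 < length (\<alpha>s ! w)" using nonempty_block w by blast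
  have "block_start \<alpha>s i + x \<le> block_start \<alpha>s w + 0 \<and> block_start \<alpha>s w + 0 \<le> block_start \<alpha>s j + y"
    using straddling_spanD[of u s v t w 0] s t uv w w0 lt ne ij by simp
  then show "i \<le> w \<and> w \<le> j"
    using block_index_mono[of \<alpha>s i x w 0] block_index_mono[of \<alpha>s w 0 j y] w0 y by auto
qed (use ij in auto)

text \<open>Suppose that the first \<open>x > 0\<close> letters of block \<open>i\<close> are missing from the span.  If a missing letter
  stood on the wrong side of a letter of the same block inside the span, it would have a value between
  that letter and block \<open>j\<close>; hence \<open>x\<close> is a cut of block \<open>i\<close>.  Similarly, the values of block \<open>i\<close> cannot
  lie between those of two other blocks of the span.\<close>

lemma left_end_of_straddling_span:
  assumes "0 < x"
  shows "\<pi> ! i < \<pi> ! j \<Longrightarrow> cut (<) (\<alpha>s ! i) x"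
    and "\<pi> ! j < \<pi> ! i \<Longrightarrow> cut (>) (\<alpha>s ! i) x"
    and "i < u \<Longrightarrow> u \<le> j \<Longrightarrow> i < v \<Longrightarrow> v \<le> j \<Longrightarrow> \<pi> ! u < \<pi> ! i \<Longrightarrow> \<pi> ! i < \<pi> ! v \<Longrightarrow> False"
proof -
  have ne: "\<alpha>s ! i ! s \<noteq> \<alpha>s ! i ! t" if "s < x" "x \<le> t" "t < length (\<alpha>s ! i)" for s t
    using that x distinct_block[OF straddling_left_block_less] by (simp add: nth_eq_iff_index_eq)
  have i0: "i \<le> j" using ij by simp
  show "cut (<) (\<alpha>s ! i) x" if lt: "\<pi> ! i < \<pi> ! j"
    unfolding cut_def
  proof (intro conjI allI impI assms x; elim conjE)
    fix s t assume st: "s < x" "x \<le> t" "t < length (\<alpha>s ! i)"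
    show "\<alpha>s ! i ! s < \<alpha>s ! i ! t"
    proof (rule ccontr)
      assume "\<not> ?thesis"
      then have "\<alpha>s ! i ! t < \<alpha>s ! i ! s" using ne[OF st] by simp
      then show False
        using straddling_spanD[of i t j y i s] st x y lt ij straddling_left_block_less straddling_span_first_inside[of j]
          block_start_add_le[OF ij(1), of \<alpha>s] by auto
    qed
  qed
  show "cut (>) (\<alpha>s ! i) x" if lt: "\<pi> ! j < \<pi> ! i"
    unfolding cut_def
  proof (intro conjI allI impI assms x; elim conjE)
    fix s t assume st: "s < x" "x \<le> t" "t < length (\<alpha>s ! i)"
    show "\<alpha>s ! i ! t < \<alpha>s ! i ! s"
    proof (rule ccontr)
      assume "\<not> ?thesis"
      then have "\<alpha>s ! i ! s < \<alpha>s ! i ! t" using ne[OF st] by simp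
      then show False
        using straddling_spanD[of j y i t i s] st x y lt ij straddling_left_block_less straddling_span_first_inside[of j]
          block_start_add_le[OF ij(1), of \<alpha>s] by auto
    qed
  qed
  show False if "i < u" "u \<le> j" "i < v" "v \<le> j" "\<pi> ! u < \<pi> ! i" "\<pi> ! i < \<pi> ! v"
  proof -
    have "u \<noteq> i" "v \<noteq> i" "u < length \<pi>" "v < length \<pi>" using that ij by auto
    then show False
      using straddling_spanD[of u 0 v 0 i 0] that nonempty_block[of u] nonempty_block[of v]
        nonempty_block[OF straddling_left_block_less] straddling_span_first_inside[of u] straddling_span_first_inside[of v] straddling_left_block_less assms by simp
  qed
qed

text \<open>The mirror image, with the final letters of block \<open>j\<close> missing from the span.\<close>

lemma right_end_of_straddling_span:
  assumes "Suc y < length (\<alpha>s ! j)"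
  shows "\<pi> ! i < \<pi> ! j \<Longrightarrow> cut (<) (\<alpha>s ! j) (Suc y)"
    and "\<pi> ! j < \<pi> ! i \<Longrightarrow> cut (>) (\<alpha>s ! j) (Suc y)"
    and "i \<le> u \<Longrightarrow> u < j \<Longrightarrow> i \<le> v \<Longrightarrow> v < j \<Longrightarrow> \<pi> ! u < \<pi> ! j \<Longrightarrow> \<pi> ! j < \<pi> ! v \<Longrightarrow> False"
proof -
  have ne: "\<alpha>s ! j ! s \<noteq> \<alpha>s ! j ! t" if "s < Suc y" "Suc y \<le> t" "t < length (\<alpha>s ! j)" for s t
    using that y distinct_block[OF ij(2)] by (simp add: nth_eq_iff_index_eq)
  show "cut (<) (\<alpha>s ! j) (Suc y)" if lt: "\<pi> ! i < \<pi> ! j"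
    unfolding cut_def
  proof (intro conjI allI impI assms zero_less_Suc; elim conjE)
    fix s t assume st: "s < Suc y" "Suc y \<le> t" "t < length (\<alpha>s ! j)"
    show "\<alpha>s ! j ! s < \<alpha>s ! j ! t"
    proof (rule ccontr)
      assume "\<not> ?thesis"
      then have "\<alpha>s ! j ! t < \<alpha>s ! j ! s" using ne[OF st] by simp
      then show False
        using straddling_spanD[of i x j s j t] st x y lt ij straddling_left_block_less straddling_span_first_inside[of j]
          block_start_add_le[OF ij(1), of \<alpha>s] by auto
    qed
  qed
  show "cut (>) (\<alpha>s ! j) (Suc y)" if lt: "\<pi> ! j < \<pi> ! i"
    unfolding cut_def
  proof (intro conjI allI impI assms zero_less_Suc; elim conjE)
    fix s t assume st: "s < Suc y" "Suc y \<le> t" "t < length (\<alpha>s ! j)"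
    show "\<alpha>s ! j ! t < \<alpha>s ! j ! s"
    proof (rule ccontr)
      assume "\<not> ?thesis"
      then have "\<alpha>s ! j ! s < \<alpha>s ! j ! t" using ne[OF st] by simp
      then show False
        using straddling_spanD[of j s i x j t] st x y lt ij straddling_left_block_less straddling_span_first_inside[of j]
          block_start_add_le[OF ij(1), of \<alpha>s] by auto
    qed
  qed
  show False if uv: "i \<le> u" "u < j" "i \<le> v" "v < j" and lt: "\<pi> ! u < \<pi> ! j" "\<pi> ! j < \<pi> ! v"
  proof -
    have ex: "\<exists>s<length (\<alpha>s ! w). block_start \<alpha>s i + x \<le> block_start \<alpha>s w + s \<and>
        block_start \<alpha>s w + s \<le> block_start \<alpha>s j + y" if "i \<le> w" "w < j" for w
      using straddling_span_last_inside[OF that] nonempty_block[of w] that ij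
      by (intro exI[of _ "length (\<alpha>s ! w) - 1"]) auto
    obtain s where s: "s < length (\<alpha>s ! u)" "block_start \<alpha>s i + x \<le> block_start \<alpha>s u + s"
        "block_start \<alpha>s u + s \<le> block_start \<alpha>s j + y"
      using ex uv(1,2) by blast
    obtain t where t: "t < length (\<alpha>s ! v)" "block_start \<alpha>s i + x \<le> block_start \<alpha>s v + t"
        "block_start \<alpha>s v + t \<le> block_start \<alpha>s j + y"
      using ex uv(3,4) by blast
    show False
      using straddling_spanD[of u s v t j "Suc y"] s t uv lt ij assms by simp
  qed
qed

text \<open>If \<open>\<pi>\<close> is monotone, a missing letter gives a cut, which tightness excludes.  Otherwise \<open>(i, j)\<close> is a
  nontrivial interval of \<open>\<pi>\<close> and so all of \<open>\<pi>\<close>; a missing letter in the first block makes the first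
  letter of \<open>\<pi>\<close> extremal, and removing an extremal end letter of \<open>\<pi>\<close> leaves an interval, which is
  nontrivial because \<open>\<pi>\<close> has at least four letters.\<close>

lemma straddling_span_full:
  assumes "tight_inflation \<pi> \<alpha>s"
  shows "x = 0 \<and> Suc y = length (\<alpha>s ! j)"
proof -
  have mem: "\<alpha>s ! i \<in> set \<alpha>s" "\<alpha>s ! j \<in> set \<alpha>s" using ij len by auto
  consider (simple) "4 \<le> length \<pi>"
      "\<forall>a b. (a, b) \<in> interval_spans \<pi> \<longrightarrow> a = b \<or> a = 0 \<and> Suc b = length \<pi>"
    | (up) "\<pi> ! i < \<pi> ! j" "\<forall>\<alpha>\<in>set \<alpha>s. \<forall>x. \<not> cut (<) \<alpha> x"
    | (down) "\<pi> ! j < \<pi> ! i" "\<forall>\<alpha>\<in>set \<alpha>s. \<forall>x. \<not> cut (>) \<alpha> x"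
    using assms ij unfolding tight_inflation_def sorted_wrt_iff_nth_less by blast
  then show ?thesis
  proof cases
    case simple
    then have ends: "i = 0" "Suc j = length \<pi>" using outer_span_of_straddling_span ij by auto
    have "x = 0"
    proof (rule ccontr)
      assume "x \<noteq> 0"
      then have extreme: "\<not> (\<pi> ! u < \<pi> ! i \<and> \<pi> ! i < \<pi> ! v)" if "i < u" "u \<le> j" "i < v" "v \<le> j" for u v
        using left_end_of_straddling_span(3) that by blast
      have "(Suc i, j) \<in> interval_spans \<pi>"
      proof (rule interval_spansI)
        fix u v w assume uv: "Suc i \<le> u" "u \<le> j" "Suc i \<le> v" "v \<le> j" "w < length \<pi>"
          and lt: "\<pi> ! u < \<pi> ! w" "\<pi> ! w < \<pi> ! v"
        have "w \<noteq> i" using extreme[of u v] uv lt by auto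
        then show "Suc i \<le> w \<and> w \<le> j" using uv ends by auto
      qed (use ij in auto)
      then have "Suc i = j" using simple(2) by blast
      then show False using simple(1) ends by simp
    qed
    moreover have "Suc y = length (\<alpha>s ! j)"
    proof (rule ccontr)
      assume "Suc y \<noteq> length (\<alpha>s ! j)"
      then have "Suc y < length (\<alpha>s ! j)" using y by simp
      then have extreme: "\<not> (\<pi> ! u < \<pi> ! j \<and> \<pi> ! j < \<pi> ! v)" if "i \<le> u" "u < j" "i \<le> v" "v < j" for u v
        using right_end_of_straddling_span(3) that by blast
      have "(i, j - 1) \<in> interval_spans \<pi>"
      proof (rule interval_spansI)
        fix u v w assume uv: "i \<le> u" "u \<le> j - 1" "i \<le> v" "v \<le> j - 1" "w < length \<pi>"
          and lt: "\<pi> ! u < \<pi> ! w" "\<pi> ! w < \<pi> ! v"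
        have "u < j" "v < j" using uv ij by auto
        then have "w \<noteq> j" using extreme[of u v] uv lt by auto
        then show "i \<le> w \<and> w \<le> j - 1" using uv ends by auto
      qed (use ij in auto)
      then have "i = j - 1" using simple(2) ij by fastforce
      then show False using simple(1) ends by simp
    qed
    ultimately show ?thesis by simp
  next
    case up
    then show ?thesis
      using left_end_of_straddling_span(1) right_end_of_straddling_span(1) mem y
      by (metis gr0I le_neq_implies_less Suc_leI)
  next
    case down
    then show ?thesis
      using left_end_of_straddling_span(2) right_end_of_straddling_span(2) mem y
      by (metis gr0I le_neq_implies_less Suc_leI)
  qed
qed

end

lemma inflate_span_cases:
  assumes tight: "tight_inflation \<pi> \<alpha>s" and pq: "(p, q) \<in> interval_spans (inflate \<pi> \<alpha>s)"
  obtains (outer) u v where "(u, v) \<in> interval_spans \<pi>" "u < v"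
      "p = block_start \<alpha>s u" "q = block_start \<alpha>s (Suc v) - 1"
    | (inner) i x y where "i < length \<pi>" "(x, y) \<in> interval_spans (\<alpha>s ! i)"
      "p = block_start \<alpha>s i + x" "q = block_start \<alpha>s i + y"
proof -
  have le: "p \<le> q" "q < block_start \<alpha>s (length \<pi>)"
    using interval_spans_bounds[OF pq] by (auto simp: length_inflate_block_start)
  then have "p < block_start \<alpha>s (length \<pi>)" by simp
  then obtain i x where i: "i < length \<pi>" "x < length (\<alpha>s ! i)" "p = block_start \<alpha>s i + x"
    by (rule block_position_cases)
  obtain j y where j: "j < length \<pi>" "y < length (\<alpha>s ! j)" "q = block_start \<alpha>s j + y"
    using le(2) by (rule block_position_cases)
  have "i \<le> j" using block_index_mono[of \<alpha>s i x j y] le i j by simp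
  then consider "i = j" | "i < j" by linarith
  then show thesis
  proof cases
    case 1
    then show thesis
      using inner[OF i(1) _ i(3)] block_span_of_inflate_span[OF i(1), of x y] pq le i j by auto
  next
    case 2
    note s = pq[unfolded i(3) j(3)]
    note f = straddling_span_full[OF 2 j(1) i(2) j(2) s tight]
    have "q = block_start \<alpha>s (Suc j) - 1" unfolding j(3) block_start_Suc using f by linarith
    moreover have "p = block_start \<alpha>s i" using f i by simp
    ultimately show thesis
      using outer[OF outer_span_of_straddling_span[OF 2 j(1) i(2) j(2) s] 2] by blast
  qed
qed

end

section \<open>Replacing the minimal elements by embedded posets\<close>

text \<open>A minimal element of \<open>R\<close> at position \<open>i\<close> is replaced by the intervals inside block \<open>i\<close>, and any other
  element keeps its blocks and takes all of their positions.  By \<open>inflate_span_cases\<close> this reaches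
  every interval of the inflation.  Positions of \<open>\<sigma>\<close> are ordered lexicographically, by block and then by
  offset, so that the relations between elements with different heads are those of \<open>R\<close>.\<close>

lemma replace_minimals_span_isomorphism:
  assumes dist: "distinct \<pi>" and len: "length \<alpha>s = length \<pi>"
    and perms: "\<forall>\<alpha>\<in>set \<alpha>s. is_permutation \<alpha>"
    and tight: "tight_inflation \<pi> \<alpha>s"
    and R: "span_isomorphism \<pi> R g"
    and Es: "\<And>i. i < length \<pi> \<Longrightarrow> span_isomorphism (\<alpha>s ! i) (Es ! i) (f i)"
  shows "\<exists>h. span_isomorphism (inflate \<pi> \<alpha>s) (replace_minimals R Es) h"
proof -
  let ?s = "block_start \<alpha>s"
  define N where "N = nodes (replace_minimals R Es)"
  define h where "h p = (if hd p \<in> minimals R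
      then (?s (fst (g (hd p))) + fst (f (fst (g (hd p))) (tl p)),
            ?s (fst (g (hd p))) + snd (f (fst (g (hd p))) (tl p)))
      else (?s (fst (g (hd p))), ?s (Suc (snd (g (hd p)))) - 1))" for p
  note minR = minimals_span_isomorphism[OF R] and rank = min_rank_span_isomorphism[OF R]
  note pos = nonempty_block[OF dist len perms]
  have N: "p \<in> N \<longleftrightarrow> p \<noteq> [] \<and> hd p \<in> nodes R \<and>
      (if hd p \<in> minimals R then tl p \<in> nodes (Es ! fst (g (hd p))) else tl p = [])" for p
  proof -
    have "p \<in> N \<longleftrightarrow> p \<in> {[r] | r. r \<in> nodes R - minimals R} \<union>
        {m # x | m x. m \<in> minimals R \<and> x \<in> nodes (Es ! min_rank R m)}"
      by (simp add: N_def replace_minimals_def Let_def)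
    also have "\<dots> \<longleftrightarrow> p \<noteq> [] \<and> hd p \<in> nodes R \<and>
        (if hd p \<in> minimals R then tl p \<in> nodes (Es ! fst (g (hd p))) else tl p = [])"
      by (cases p) (auto simp: rank minR)
    finally show ?thesis .
  qed
  have order: "order (replace_minimals R Es) = {(p, q). p \<in> N \<and> q \<in> N \<and>
      (if hd p = hd q \<and> hd p \<in> minimals R
       then (tl p, tl q) \<in> order (Es ! min_rank R (hd p)) else (hd p, hd q) \<in> order R)}"
    and left: "left (replace_minimals R Es) = {(p, q). p \<in> N \<and> q \<in> N \<and>
      (if hd p = hd q \<and> hd p \<in> minimals R
       then (tl p, tl q) \<in> left (Es ! min_rank R (hd p)) else (hd p, hd q) \<in> left R)}"
    by (simp_all add: N_def replace_minimals_def Let_def)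

  have inner: "h p = (?s i + x, ?s i + y) \<and> (x, y) \<in> interval_spans (\<alpha>s ! i) \<and>
      x \<le> y \<and> y < length (\<alpha>s ! i) \<and> i < length \<pi> \<and> tl p \<in> nodes (Es ! i)"
    if "p \<in> N" "hd p \<in> minimals R" "i = fst (g (hd p))" "(x, y) = f i (tl p)" for p i x y
  proof -
    have "hd p \<in> nodes R" "snd (g (hd p)) = i" using that minR by auto
    then have i: "i < length \<pi>" using span_isomorphism_bounds[OF R] by metis
    have t: "tl p \<in> nodes (Es ! i)" using that N by auto
    show ?thesis
      using span_isomorphism_bounds[OF Es[OF i] t] i t that(2,3)
      by (simp add: h_def that(4)[unfolded that(3), symmetric])
  qed
  \<comment> \<open>the first and the last position of a node lie in the first and the last block of its head\<close>
  have blocks: "\<exists>x y. g (hd p) = (u, v) \<longrightarrow> u \<le> v \<and> v < length \<pi> \<and> h p = (?s u + x, ?s v + y) \<and>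
      x < length (\<alpha>s ! u) \<and> y < length (\<alpha>s ! v) \<and> (u < v \<longrightarrow> x = 0 \<and> Suc y = length (\<alpha>s ! v))"
    if p: "p \<in> N" for p u v
  proof (cases "g (hd p) = (u, v)")
    case g: True
    have hd: "hd p \<in> nodes R" using p N by simp
    have uv: "u \<le> v" "v < length \<pi>" using span_isomorphism_bounds[OF R hd] g by auto
    show ?thesis
    proof (cases "hd p \<in> minimals R")
      case True
      then have "v = u" using g minR by simp
      moreover obtain x y where "(x, y) = f u (tl p)" by (metis surj_pair)
      ultimately show ?thesis using inner[OF p True, of u x y] g uv by (intro exI[of _ x] exI[of _ y]) auto
    next
      case False
      then have "u < v" using g minR hd uv by auto
      moreover obtain l where "length (\<alpha>s ! v) = Suc l"
        using pos[OF uv(2)] by (cases "length (\<alpha>s ! v)") auto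
      ultimately show ?thesis
        using False g uv pos[of u]
        by (intro exI[where x = "0::nat"] exI[where x = l]) (auto simp: h_def block_start_Suc)
    qed
  qed simp
  have compare: "((hd p, hd q) \<in> order R \<longleftrightarrow> fst (h q) \<le> fst (h p) \<and> snd (h p) \<le> snd (h q)) \<and>
      ((hd p, hd q) \<in> left R \<longleftrightarrow> fst (h p) < fst (h q) \<and> snd (h p) < snd (h q))"
    if p: "p \<in> N" and q: "q \<in> N" and ne: "\<not> (hd p = hd q \<and> hd p \<in> minimals R)" for p q
  proof -
    have hd: "hd p \<in> nodes R" "hd q \<in> nodes R" using p q N by auto
    obtain u v u' v' where g: "g (hd p) = (u, v)" "g (hd q) = (u', v')" by (metis surj_pair)
    obtain x y where P: "u \<le> v" "h p = (?s u + x, ?s v + y)"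
        "x < length (\<alpha>s ! u)" "y < length (\<alpha>s ! v)" "u < v \<longrightarrow> x = 0 \<and> Suc y = length (\<alpha>s ! v)"
      using blocks[OF p] g by blast
    obtain x' y' where Q: "u' \<le> v'" "h q = (?s u' + x', ?s v' + y')"
        "x' < length (\<alpha>s ! u')" "y' < length (\<alpha>s ! v')" "u' < v' \<longrightarrow> x' = 0 \<and> Suc y' = length (\<alpha>s ! v')"
      using blocks[OF q] g by blast
    have R': "(hd p, hd q) \<in> order R \<longleftrightarrow> u' \<le> u \<and> v \<le> v'" "(hd p, hd q) \<in> left R \<longleftrightarrow> u < u' \<and> v < v'"
      using hd g by (simp_all add: span_isomorphism_order[OF R] span_isomorphism_left[OF R])
    have not_same: "\<not> (u = u' \<and> v = v' \<and> u = v)"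
      using ne g minR hd(1) span_isomorphism_inj[OF R hd] by auto
    have lex: "?s a + c \<le> ?s b + d \<longleftrightarrow> a < b \<or> a = b \<and> c \<le> d"
      if "c < length (\<alpha>s ! a)" "d < length (\<alpha>s ! b)" for a b c d
      using that block_index_mono[of \<alpha>s a c b d] block_start_add_le[of a b \<alpha>s] by fastforce
    have "u' \<le> u \<and> v \<le> v' \<longleftrightarrow> ?s u' + x' \<le> ?s u + x \<and> ?s v + y \<le> ?s v' + y'"
      unfolding lex[OF Q(3) P(3)] lex[OF P(4) Q(4)] using P(1,4,5) Q(1,4,5) not_same
      by (cases "u = u'"; cases "v = v'"; cases "u = v"; cases "u' = v'") auto
    moreover have "u < u' \<and> v < v' \<longleftrightarrow> \<not> ?s u' + x' \<le> ?s u + x \<and> \<not> ?s v' + y' \<le> ?s v + y"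
      unfolding lex[OF Q(3) P(3)] lex[OF Q(4) P(4)] using P(1,4,5) Q(1,4,5) not_same
      by (cases "u = u'"; cases "v = v'"; cases "u = v"; cases "u' = v'") auto
    ultimately show ?thesis by (simp add: R' P(2) Q(2) not_le)
  qed
  have compare_inner: "((tl p, tl q) \<in> order (Es ! min_rank R (hd p)) \<longleftrightarrow>
        fst (h q) \<le> fst (h p) \<and> snd (h p) \<le> snd (h q)) \<and>
      ((tl p, tl q) \<in> left (Es ! min_rank R (hd p)) \<longleftrightarrow> fst (h p) < fst (h q) \<and> snd (h p) < snd (h q))"
    if p: "p \<in> N" and q: "q \<in> N" and eq: "hd p = hd q" "hd p \<in> minimals R" for p q
  proof -
    define i where "i = fst (g (hd p))"
    obtain x y where f: "(x, y) = f i (tl p)" by (metis surj_pair)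
    obtain x' y' where f': "(x', y') = f i (tl q)" by (metis surj_pair)
    note P = inner[OF p eq(2) i_def f] and Q = inner[OF q eq(2)[unfolded eq(1)] i_def[unfolded eq(1)] f']
    then have i: "i < length \<pi>" by blast
    show ?thesis
      unfolding rank[OF eq(2)] i_def[symmetric]
      using P Q by (simp add: span_isomorphism_order[OF Es[OF i]] span_isomorphism_left[OF Es[OF i]]
          f[symmetric] f'[symmetric])
  qed
  have compare_order: "(if hd p = hd q \<and> hd p \<in> minimals R
      then (tl p, tl q) \<in> order (Es ! min_rank R (hd p)) else (hd p, hd q) \<in> order R) \<longleftrightarrow>
      fst (h q) \<le> fst (h p) \<and> snd (h p) \<le> snd (h q)" if "p \<in> N" "q \<in> N" for p q
    using compare[OF that] compare_inner[OF that] by argo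
  have compare_left: "(if hd p = hd q \<and> hd p \<in> minimals R
      then (tl p, tl q) \<in> left (Es ! min_rank R (hd p)) else (hd p, hd q) \<in> left R) \<longleftrightarrow>
      fst (h p) < fst (h q) \<and> snd (h p) < snd (h q)" if "p \<in> N" "q \<in> N" for p q
    using compare[OF that] compare_inner[OF that] by argo
  have "span_isomorphism (inflate \<pi> \<alpha>s) (replace_minimals R Es) h"
    unfolding span_isomorphism_def N_def[symmetric]
  proof (intro conjI)
    show "order (replace_minimals R Es) =
        {(p, q). p \<in> N \<and> q \<in> N \<and> fst (h q) \<le> fst (h p) \<and> snd (h p) \<le> snd (h q)}"
      unfolding order using compare_order by blast
    show "left (replace_minimals R Es) =
        {(p, q). p \<in> N \<and> q \<in> N \<and> fst (h p) < fst (h q) \<and> snd (h p) < snd (h q)}"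
      unfolding left using compare_left by blast
    show "bij_betw h N (interval_spans (inflate \<pi> \<alpha>s))"
      unfolding bij_betw_def
    proof (intro conjI inj_onI equalityI subsetI)
      fix p q assume p: "p \<in> N" and q: "q \<in> N" and h: "h p = h q"
      obtain u v u' v' where g: "g (hd p) = (u, v)" "g (hd q) = (u', v')" by (metis surj_pair)
      obtain x y where P: "h p = (?s u + x, ?s v + y)" "x < length (\<alpha>s ! u)" "y < length (\<alpha>s ! v)"
        using blocks[OF p] g by blast
      obtain x' y' where Q: "h q = (?s u' + x', ?s v' + y')" "x' < length (\<alpha>s ! u')" "y' < length (\<alpha>s ! v')"
        using blocks[OF q] g by blast
      have "?s u + x = ?s u' + x'" "?s v + y = ?s v' + y'" using h P(1) Q(1) by simp_all
      then have "u = u'" "v = v'"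
        unfolding block_position_eq_iff[OF P(2) Q(2)] block_position_eq_iff[OF P(3) Q(3)] by simp_all
      then have hd: "hd p = hd q" using g p q N span_isomorphism_inj[OF R] by metis
      have "tl p = tl q"
      proof (cases "hd p \<in> minimals R")
        case True
        then have v: "v = u" using g minR by auto
        obtain x y where f: "(x, y) = f u (tl p)" by (metis surj_pair)
        obtain x' y' where f': "(x', y') = f u (tl q)" by (metis surj_pair)
        have P: "h p = (?s u + x, ?s u + y) \<and> u < length \<pi> \<and> tl p \<in> nodes (Es ! u)"
          using inner[OF p True _ f] g by simp
        have Q: "h q = (?s u + x', ?s u + y') \<and> u < length \<pi> \<and> tl q \<in> nodes (Es ! u)"
          using inner[OF q _ _ f'] g True hd by simp
        have "f u (tl p) = f u (tl q)" using P Q h by (simp add: f[symmetric] f'[symmetric])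
        then show ?thesis using P Q span_isomorphism_inj[OF Es] by blast
      next
        case False
        then show ?thesis using p q hd N by metis
      qed
      then show "p = q" using hd p q N by (metis list.expand)
    next
      fix z assume "z \<in> h ` N"
      then obtain p where p: "p \<in> N" "z = h p" by blast
      have hd: "hd p \<in> nodes R" using p N by simp
      show "z \<in> interval_spans (inflate \<pi> \<alpha>s)"
      proof (cases "hd p \<in> minimals R")
        case True
        obtain x y where f: "(x, y) = f (fst (g (hd p))) (tl p)" by (metis surj_pair)
        show ?thesis
          using inner[OF p(1) True refl f] inflate_span_of_block_span[OF dist len perms] p(2) by auto
      next
        case False
        then show ?thesis
          using inflate_span_of_outer_span[OF dist len perms, of "fst (g (hd p))" "snd (g (hd p))"]
            span_isomorphism_bounds(1)[OF R hd] p(2) by (simp add: h_def)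
      qed
    next
      fix z assume z: "z \<in> interval_spans (inflate \<pi> \<alpha>s)"
      obtain p q where pq: "z = (p, q)" by (metis surj_pair)
      show "z \<in> h ` N"
      proof (rule inflate_span_cases[OF dist len perms tight z[unfolded pq]], goal_cases outer inner)
        case (outer u v)
        obtain r where r: "r \<in> nodes R" "g r = (u, v)" using outer(1) by (rule span_isomorphism_node[OF R])
        then have "r \<notin> minimals R" using outer(2) minR by simp
        then show ?thesis
          using r outer pq by (intro image_eqI[of _ _ "[r]"]) (simp_all add: N h_def)
      next
        case (inner i x y)
        obtain m where m: "m \<in> nodes R" "g m = (i, i)"
          using singleton_in_interval_spans[OF inner(1)] by (rule span_isomorphism_node[OF R])
        obtain t where t: "t \<in> nodes (Es ! i)" "f i t = (x, y)"
          using inner(2) by (rule span_isomorphism_node[OF Es[OF inner(1)]])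
        have "m \<in> minimals R" using m minR by simp
        then show ?thesis
          using m t inner pq by (intro image_eqI[of _ _ "m # t"]) (simp_all add: N h_def)
      qed
    qed
  qed
  then show ?thesis by blast
qed

section \<open>Words composed of interval blocks\<close>

lemma in_set_concat_iff: "v \<in> set (concat bs) \<longleftrightarrow> (\<exists>i<length bs. v \<in> set (bs ! i))"
  by (metis UN_iff set_concat in_set_conv_nth)

definition convex_values :: "nat set \<Rightarrow> bool" where
  "convex_values S \<longleftrightarrow> (\<forall>x\<in>S. \<forall>z\<in>S. \<forall>y. x < y \<and> y < z \<longrightarrow> y \<in> S)"

lemma convex_values_eq_interval:
  assumes "convex_values (set b)" "distinct b" "b \<noteq> []"
  shows "set b = {Min (set b)..<Min (set b) + length b}"
proof -
  let ?m = "Min (set b)" and ?M = "Max (set b)"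
  have eq: "set b = {?m..?M}"
    using assms(1,3) unfolding convex_values_def by (intro convex_nat_set) (simp, simp, blast)
  have "?m \<le> ?M" using assms(3) by simp
  moreover have "length b = Suc ?M - ?m" using distinct_card[OF assms(2)] eq by (metis card_atLeastAtMost)
  ultimately have "{?m..?M} = {?m..<?m + length b}" by auto
  with eq show ?thesis by simp
qed

definition interval_blocks :: "nat list \<Rightarrow> nat list list \<Rightarrow> bool" where
  "interval_blocks \<sigma> bs \<longleftrightarrow> concat bs = \<sigma> \<and> [] \<notin> set bs \<and> (\<forall>b\<in>set bs. convex_values (set b))"

text \<open>Ranking the blocks by their least values gives the outer permutation, and standardizing each block
  gives the inner ones.  The shift that inflation applies to a block counts the values in all lower
  blocks; these are exactly the values below its minimum, so the block is restored.\<close>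

lemma interval_blocks_inflate:
  assumes perm: "is_permutation \<sigma>" and bs: "interval_blocks \<sigma> bs"
  obtains \<pi> \<alpha>s where "is_permutation \<pi>" "length \<pi> = length bs" "length \<alpha>s = length bs"
    "\<forall>\<alpha>\<in>set \<alpha>s. is_permutation \<alpha>" "\<sigma> = inflate \<pi> \<alpha>s"
    "\<And>i. i < length bs \<Longrightarrow> \<exists>s. bs ! i = map (\<lambda>x. x + s) (\<alpha>s ! i)"
    "\<And>i j x y. i < length bs \<Longrightarrow> j < length bs \<Longrightarrow> i \<noteq> j \<Longrightarrow> x \<in> set (bs ! i) \<Longrightarrow>
      y \<in> set (bs ! j) \<Longrightarrow> x < y \<longleftrightarrow> \<pi> ! i < \<pi> ! j"
proof -
  define k where "k = length bs"
  define c where "c i = Min (set (bs ! i))" for i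
  define \<pi> where "\<pi> = map (\<lambda>i. card {j \<in> {..<k}. c j \<le> c i}) [0..<k]"
  define \<alpha>s where "\<alpha>s = map (\<lambda>i. map (\<lambda>x. Suc x - c i) (bs ! i)) [0..<k]"
  have \<sigma>: "\<sigma> = concat bs" "distinct \<sigma>" "set \<sigma> = {1..length \<sigma>}" "\<sigma> \<noteq> []"
    using perm bs by (auto simp: is_permutation_def interval_blocks_def)
  have ne: "bs ! i \<noteq> []" and conv: "convex_values (set (bs ! i))" if "i < k" for i
  proof -
    have "bs ! i \<in> set bs" using that by (simp add: k_def)
    then show "bs ! i \<noteq> []" "convex_values (set (bs ! i))"
      using bs unfolding interval_blocks_def by metis+
  qed
  have dist: "distinct (bs ! i)" if "i < k" for i
    using \<sigma>(1,2) that by (auto simp: distinct_concat_iff k_def)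
  have "removeAll [] bs = bs" using bs by (auto simp: interval_blocks_def)
  then have "distinct bs" using \<sigma>(1,2) by (simp add: distinct_concat_iff)
  then have disj: "set (bs ! i) \<inter> set (bs ! j) = {}" if "i < k" "j < k" "i \<noteq> j" for i j
    using \<sigma>(1,2) that by (auto simp: distinct_concat_iff k_def nth_eq_iff_index_eq)
  have block: "set (bs ! i) = {c i..<c i + length (bs ! i)}" if "i < k" for i
    unfolding c_def using convex_values_eq_interval conv dist ne that by blast
  have c_mem: "c i \<in> set (bs ! i)" if "i < k" for i using ne[OF that] by (simp add: c_def)
  have block_\<sigma>: "set (bs ! i) \<subseteq> set \<sigma>" if "i < k" for i
    using that unfolding \<sigma>(1) k_def in_set_concat_iff subset_iff by blast
  have c_pos: "1 \<le> c i" if "i < k" for i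
    using c_mem[OF that] block_\<sigma>[OF that] \<sigma>(3) by auto
  have gap: "c j + length (bs ! j) \<le> c i" if "i < k" "j < k" "c j < c i" for i j
  proof (rule ccontr)
    assume "\<not> ?thesis"
    then have "c i \<in> set (bs ! j)" using that block by auto
    then show False using disj[of i j] c_mem that by auto
  qed
  have c_inj: "c i \<noteq> c j" if "i < k" "j < k" "i \<noteq> j" for i j
    using disj[OF that] c_mem that by (metis disjoint_iff)
  have \<pi>_nth: "\<pi> ! i = card {j \<in> {..<k}. c j \<le> c i}" if "i < k" for i
    using that by (simp add: \<pi>_def)
  have \<pi>_mono: "\<pi> ! i < \<pi> ! j" if "i < k" "j < k" "c i < c j" for i j
  proof -
    have "{l \<in> {..<k}. c l \<le> c i} \<subseteq> {l \<in> {..<k}. c l \<le> c j}" using that by auto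
    moreover have "j \<in> {l \<in> {..<k}. c l \<le> c j}" "j \<notin> {l \<in> {..<k}. c l \<le> c i}"
      using that by auto
    ultimately have "{l \<in> {..<k}. c l \<le> c i} \<subset> {l \<in> {..<k}. c l \<le> c j}" by blast
    then show ?thesis
      unfolding \<pi>_nth[OF that(1)] \<pi>_nth[OF that(2)] by (intro psubset_card_mono) simp_all
  qed
  have \<pi>_less: "\<pi> ! i < \<pi> ! j \<longleftrightarrow> c i < c j" if "i < k" "j < k" for i j
    using \<pi>_mono[of i j] \<pi>_mono[of j i] c_inj[of i j] that by (metis less_asym nat_neq_iff)
  have len: "length \<pi> = k" "length \<alpha>s = k" by (simp_all add: \<pi>_def \<alpha>s_def)
  have \<alpha>_nth: "\<alpha>s ! i = map (\<lambda>x. Suc x - c i) (bs ! i)" if "i < k" for i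
    using that by (simp add: \<alpha>s_def)
  have k0: "0 < k" using \<sigma>(1,4) by (auto simp: k_def)

  have perm_\<pi>: "is_permutation \<pi>"
    unfolding is_permutation_def
  proof (intro conjI)
    show "\<pi> \<noteq> []" using k0 len by auto
    show d: "distinct \<pi>"
      unfolding distinct_conv_nth len
      using \<pi>_mono c_inj by (metis less_irrefl nat_neq_iff)
    have "set \<pi> \<subseteq> {1..length \<pi>}"
    proof
      fix v assume "v \<in> set \<pi>"
      then obtain i where i: "i < k" "v = card {j \<in> {..<k}. c j \<le> c i}"
        by (auto simp: \<pi>_def)
      have "{i} \<subseteq> {j \<in> {..<k}. c j \<le> c i}" using i by auto
      then have "card {i} \<le> v" unfolding i(2) by (intro card_mono) auto
      moreover have "v \<le> card {..<k}" unfolding i(2) by (intro card_mono) auto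
      ultimately show "v \<in> {1..length \<pi>}" using len by simp
    qed
    then show "set \<pi> = {1..length \<pi>}"
      using distinct_card[OF d] by (intro card_subset_eq) auto
  qed
  have perm_\<alpha>: "is_permutation (\<alpha>s ! i)" if i: "i < k" for i
    unfolding is_permutation_def \<alpha>_nth[OF i]
  proof (intro conjI)
    show "map (\<lambda>x. Suc x - c i) (bs ! i) \<noteq> []" using ne[OF i] by simp
    have "inj_on (\<lambda>x. Suc x - c i) (set (bs ! i))"
      unfolding block[OF i] by (rule inj_onI) auto
    then show "distinct (map (\<lambda>x. Suc x - c i) (bs ! i))"
      using dist[OF i] by (simp add: distinct_map)
    have "v \<in> (\<lambda>x. Suc x - c i) ` {c i..<c i + length (bs ! i)}" if "v \<in> {1..length (bs ! i)}" for v
      using that by (intro image_eqI[of _ _ "c i + v - 1"]) auto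
    then show "set (map (\<lambda>x. Suc x - c i) (bs ! i)) = {1..length (map (\<lambda>x. Suc x - c i) (bs ! i))}"
      by (auto simp: block[OF i])
  qed
  then have perms: "\<forall>\<alpha>\<in>set \<alpha>s. is_permutation \<alpha>" by (auto simp: in_set_conv_nth len)

  have shift: "block_shift \<pi> \<alpha>s i = c i - 1" if i: "i < k" for i
  proof -
    let ?J = "{j \<in> {..<k}. c j < c i}"
    have "block_shift \<pi> \<alpha>s i = (\<Sum>j\<in>?J. card (set (bs ! j)))"
      unfolding block_shift_def len using i dist by (intro sum.cong) (auto simp: \<pi>_less \<alpha>_nth distinct_card)
    also have "\<dots> = card (\<Union>j\<in>?J. set (bs ! j))"
      using disj by (intro card_UN_disjoint[symmetric]) auto
    also have "(\<Union>j\<in>?J. set (bs ! j)) = {1..<c i}"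
    proof (intro equalityI subsetI)
      fix v assume "v \<in> (\<Union>j\<in>?J. set (bs ! j))"
      then obtain j where j: "j < k" "c j < c i" "v \<in> set (bs ! j)" by auto
      then have "v < c i" "1 \<le> v" using gap[OF i j(1,2)] block[OF j(1)] c_pos[OF j(1)] by auto
      then show "v \<in> {1..<c i}" by simp
    next
      fix v assume v: "v \<in> {1..<c i}"
      have "c i \<in> set \<sigma>" using c_mem[OF i] block_\<sigma>[OF i] by blast
      then have "v \<in> set \<sigma>" using v unfolding \<sigma>(3) by simp
      then obtain j where j: "j < k" "v \<in> set (bs ! j)"
        unfolding \<sigma>(1) in_set_concat_iff k_def by blast
      then have "c j < c i" using block[OF j(1)] v by auto
      then show "v \<in> (\<Union>j\<in>?J. set (bs ! j))" using j by auto
    qed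
    finally show ?thesis by simp
  qed
  \<comment> \<open>standardizing turns the value \<open>x\<close> into \<open>x - c i + 1\<close>, and \<open>c i - 1\<close> values lie in lower blocks\<close>
  have restore: "map (\<lambda>x. x + (c i - 1)) (\<alpha>s ! i) = bs ! i" if "i < k" for i
    using c_pos[OF that] block[OF that] that by (auto simp: \<alpha>_nth intro!: map_idI)
  have "inflate \<pi> \<alpha>s = concat (map (\<lambda>i. map (\<lambda>x. x + block_shift \<pi> \<alpha>s i) (\<alpha>s ! i)) [0..<k])"
    by (simp add: inflate_def block_shift_def len)
  also have "map (\<lambda>i. map (\<lambda>x. x + block_shift \<pi> \<alpha>s i) (\<alpha>s ! i)) [0..<k] = map ((!) bs) [0..<k]"
    by (intro map_cong) (simp_all add: shift restore del: One_nat_def)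
  also have "\<dots> = bs" by (simp add: k_def map_nth)
  finally have inflate: "\<sigma> = inflate \<pi> \<alpha>s" by (simp add: \<sigma>(1))

  have less: "x < y \<longleftrightarrow> \<pi> ! i < \<pi> ! j"
    if "i < length bs" "j < length bs" "i \<noteq> j" "x \<in> set (bs ! i)" "y \<in> set (bs ! j)" for i j x y
  proof -
    have ij: "i < k" "j < k" using that by (auto simp: k_def)
    have "c i < c j \<or> c j < c i" using c_inj[OF ij that(3)] by auto
    then show ?thesis
      using gap[OF ij(2,1)] gap[OF ij] block[OF ij(1)] block[OF ij(2)] that(4,5) \<pi>_less[OF ij]
      by fastforce
  qed
  show thesis
    using that[of \<pi> \<alpha>s] perm_\<pi> perms inflate less restore len by (metis k_def)
qed

section \<open>Monotone blocks and cuts\<close>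

lemma increasing_perm_eqI:
  assumes "is_permutation \<pi>" "sorted_wrt (<) \<pi>"
  shows "\<pi> = increasing_perm (length \<pi>)"
proof -
  have "distinct \<pi>" "set \<pi> = {1..length \<pi>}" using assms(1) by (simp_all add: is_permutation_def)
  moreover have "set (increasing_perm (length \<pi>)) = {1..length \<pi>}"
    by (simp add: increasing_perm_def atLeastLessThanSuc_atLeastAtMost del: upt_Suc)
  moreover have "sorted (increasing_perm (length \<pi>))" "distinct (increasing_perm (length \<pi>))"
    by (simp_all add: increasing_perm_def del: upt_Suc)
  ultimately show ?thesis
    using sorted_distinct_set_unique strict_sorted_imp_sorted[OF assms(2)] by metis
qed

lemma decreasing_perm_eqI:
  assumes "is_permutation \<pi>" "sorted_wrt (>) \<pi>"
  shows "\<pi> = decreasing_perm (length \<pi>)"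
proof -
  have "rev \<pi> = increasing_perm (length (rev \<pi>))"
    using assms by (intro increasing_perm_eqI) (simp_all add: is_permutation_def sorted_wrt_rev)
  then show ?thesis by (metis decreasing_perm_def length_rev rev_rev_ident)
qed

lemma is_permutation_increasing_perm: "1 \<le> k \<Longrightarrow> is_permutation (increasing_perm k)"
  "length (increasing_perm k) = k" "sorted_wrt (<) (increasing_perm k)"
  by (auto simp: is_permutation_def increasing_perm_def simp del: upt_Suc)

lemma is_permutation_decreasing_perm: "1 \<le> k \<Longrightarrow> is_permutation (decreasing_perm k)"
  "length (decreasing_perm k) = k" "sorted_wrt (>) (decreasing_perm k)"
  using is_permutation_increasing_perm[of k] by (auto simp: decreasing_perm_def is_permutation_def sorted_wrt_rev)

lemma cut_map_add: "R = (<) \<or> R = (>) \<Longrightarrow> cut R (map (\<lambda>x. x + s) \<alpha>) x \<longleftrightarrow> cut R \<alpha> x"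
  by (auto simp: cut_def)

text \<open>For \<open>(<)\<close> and \<open>(>)\<close>, this says that the concatenation is the direct or the skew sum of the blocks.\<close>

definition blockwise :: "(nat \<Rightarrow> nat \<Rightarrow> bool) \<Rightarrow> nat list list \<Rightarrow> bool" where
  "blockwise R bs \<longleftrightarrow> sorted_wrt (\<lambda>b c. \<forall>x\<in>set b. \<forall>y\<in>set c. R x y) bs"

text \<open>A value between two values of the same block cannot occur in an earlier or a later block, as the
  values there are all smaller or all larger.\<close>

lemma blockwise_convex:
  assumes perm: "is_permutation \<sigma>" and bs: "concat bs = \<sigma>" "[] \<notin> set bs"
    and R: "R = (<) \<or> R = (>)" and sorted: "blockwise R bs"
  shows "interval_blocks \<sigma> bs"
  unfolding interval_blocks_def
proof (intro conjI bs ballI)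
  fix b assume "b \<in> set bs"
  then obtain i where i: "i < length bs" "b = bs ! i" by (auto simp: in_set_conv_nth)
  show "convex_values (set b)"
    unfolding convex_values_def
  proof (intro ballI allI impI, elim conjE)
    fix x y z assume x: "x \<in> set b" and z: "z \<in> set b" and lt: "x < y" "y < z"
    have "x \<in> set \<sigma>" "z \<in> set \<sigma>" using x z \<open>b \<in> set bs\<close> bs(1) by auto
    then have "y \<in> set \<sigma>" using lt perm by (auto simp: is_permutation_def)
    then obtain j where j: "j < length bs" "y \<in> set (bs ! j)"
      unfolding bs(1)[symmetric] in_set_concat_iff by blast
    have "R u v" if "u \<in> set (bs ! i')" "v \<in> set (bs ! j')" "i' < j'" "j' < length bs" for u v i' j'
      using sorted that by (auto simp: blockwise_def sorted_wrt_iff_nth_less)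
    then have "\<not> i < j" "\<not> j < i" using R x z i j lt by fastforce+
    then show "y \<in> set b" using i j by (metis nat_neq_iff)
  qed
qed

lemma blockwise_outer_sorted:
  assumes R: "R = (<) \<or> R = (>)" and sorted: "blockwise R bs" and "[] \<notin> set bs"
    and "length \<pi> = length bs"
    and less: "\<And>i j x y. i < length bs \<Longrightarrow> j < length bs \<Longrightarrow> i \<noteq> j \<Longrightarrow> x \<in> set (bs ! i) \<Longrightarrow>
      y \<in> set (bs ! j) \<Longrightarrow> x < y \<longleftrightarrow> \<pi> ! i < \<pi> ! j"
  shows "sorted_wrt R \<pi>"
  unfolding sorted_wrt_iff_nth_less assms(4)
proof (intro allI impI)
  fix i j assume ij: "i < j" "j < length bs"
  have "bs ! i \<in> set bs" "bs ! j \<in> set bs" using ij by simp_all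
  then have "bs ! i \<noteq> []" "bs ! j \<noteq> []" using assms(3) by metis+
  then have m: "hd (bs ! i) \<in> set (bs ! i)" "hd (bs ! j) \<in> set (bs ! j)" by auto
  then have "R (hd (bs ! i)) (hd (bs ! j))"
    using sorted ij by (auto simp: blockwise_def sorted_wrt_iff_nth_less)
  then show "R (\<pi> ! i) (\<pi> ! j)"
    using R less[OF _ _ _ m(1) m(2)] less[OF _ _ _ m(2) m(1)] ij by auto
qed

lemma cut_blockwise:
  "cut R \<alpha> x \<longleftrightarrow> 0 < x \<and> x < length \<alpha> \<and> blockwise R [take x \<alpha>, drop x \<alpha>]"
proof -
  have "(\<forall>u\<in>set (take x \<alpha>). \<forall>v\<in>set (drop x \<alpha>). R u v) \<longleftrightarrow>
      (\<forall>y<x. \<forall>z. x \<le> z \<and> z < length \<alpha> \<longrightarrow> R (\<alpha> ! y) (\<alpha> ! z))" if "x < length \<alpha>"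
  proof (intro iffI allI impI ballI; (elim conjE)?)
    fix y z assume *: "\<forall>u\<in>set (take x \<alpha>). \<forall>v\<in>set (drop x \<alpha>). R u v" and yz: "y < x" "x \<le> z" "z < length \<alpha>"
    have "take x \<alpha> ! y \<in> set (take x \<alpha>)" using yz by (intro nth_mem) simp
    moreover have "drop x \<alpha> ! (z - x) \<in> set (drop x \<alpha>)" using yz by (intro nth_mem) simp
    ultimately show "R (\<alpha> ! y) (\<alpha> ! z)" using * yz by auto
  next
    fix u v assume *: "\<forall>y<x. \<forall>z. x \<le> z \<and> z < length \<alpha> \<longrightarrow> R (\<alpha> ! y) (\<alpha> ! z)"
      and "u \<in> set (take x \<alpha>)" "v \<in> set (drop x \<alpha>)"
    then obtain y z where "y < x" "u = \<alpha> ! y" "z < length \<alpha> - x" "v = \<alpha> ! (x + z)"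
      by (auto simp: in_set_conv_nth)
    then show "R u v" using * by auto
  qed
  then show ?thesis by (auto simp: cut_def blockwise_def)
qed

lemma cut_inflate:
  assumes R: "R = (<) \<or> R = (>)" and \<pi>: "is_permutation \<pi>" "sorted_wrt R \<pi>" "2 \<le> length \<pi>"
    and \<alpha>s: "length \<alpha>s = length \<pi>" "\<forall>\<alpha>\<in>set \<alpha>s. is_permutation \<alpha>"
  shows "cut R (inflate \<pi> \<alpha>s) (length (\<alpha>s ! 0))"
proof -
  have dist: "distinct \<pi>" using \<pi>(1) by (simp add: is_permutation_def)
  note hyps = dist \<alpha>s
  have start: "block_start \<alpha>s 1 = length (\<alpha>s ! 0)" by (simp add: block_start_def)
  have pos: "0 < length (\<alpha>s ! 0)" "0 < length (\<alpha>s ! 1)"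
    using \<pi>(3) by (intro nonempty_block[OF hyps]; linarith)+
  have L: "length (\<alpha>s ! 0) < length (inflate \<pi> \<alpha>s)"
    using block_position_less[OF hyps, of 1 0] \<pi>(3) pos start by simp
  show ?thesis
    unfolding cut_def
  proof (intro conjI pos(1) L allI impI; elim conjE)
    fix y z assume yz: "y < length (\<alpha>s ! 0)" "length (\<alpha>s ! 0) \<le> z" "z < length (inflate \<pi> \<alpha>s)"
    obtain j t where j: "j < length \<pi>" "t < length (\<alpha>s ! j)" "z = block_start \<alpha>s j + t"
      using yz(3) unfolding length_inflate_block_start[OF hyps] by (rule block_position_cases)
    have "\<pi> \<noteq> []" using j(1) by auto
    have "0 < j" using block_index_mono[of \<alpha>s 1 0 j t] yz(2) j start by simp
    then have "R (\<pi> ! 0) (\<pi> ! j)" using \<pi>(2) j by (simp add: sorted_wrt_iff_nth_less)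
    then show "R (inflate \<pi> \<alpha>s ! y) (inflate \<pi> \<alpha>s ! z)"
      using R inflate_less_blockwise[OF hyps, of 0 y j t] yz(1) j \<open>0 < j\<close> \<open>\<pi> \<noteq> []\<close>
        inflate_less_blockwise[OF hyps, of j t 0 y]
      by (auto simp: block_start_def)
  qed
qed

lemma inflate_of_cut:
  assumes R: "R = (<) \<or> R = (>)" and perm: "is_permutation \<sigma>" and cut: "cut R \<sigma> x"
  obtains \<pi> \<alpha>s where "is_permutation \<pi>" "sorted_wrt R \<pi>" "length \<pi> = 2" "length \<alpha>s = 2"
    "\<forall>\<alpha>\<in>set \<alpha>s. is_permutation \<alpha>" "\<sigma> = inflate \<pi> \<alpha>s"
proof -
  let ?bs = "[take x \<sigma>, drop x \<sigma>]"
  have x: "0 < x" "x < length \<sigma>" and bw: "blockwise R ?bs" using cut by (auto simp: cut_blockwise)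
  then have ne: "[] \<notin> set ?bs" by auto
  have "interval_blocks \<sigma> ?bs" using blockwise_convex[OF perm _ ne R bw] by simp
  then show thesis
  proof (rule interval_blocks_inflate[OF perm])
    fix \<pi> \<alpha>s
    assume *: "is_permutation \<pi>" "length \<pi> = length ?bs" "length \<alpha>s = length ?bs"
      "\<forall>\<alpha>\<in>set \<alpha>s. is_permutation \<alpha>" "\<sigma> = inflate \<pi> \<alpha>s"
      and less: "\<And>i j x' y. i < length ?bs \<Longrightarrow> j < length ?bs \<Longrightarrow> i \<noteq> j \<Longrightarrow> x' \<in> set (?bs ! i) \<Longrightarrow>
        y \<in> set (?bs ! j) \<Longrightarrow> x' < y \<longleftrightarrow> \<pi> ! i < \<pi> ! j"
    have "sorted_wrt R \<pi>" by (rule blockwise_outer_sorted[OF R bw ne *(2) less])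
    then show thesis using that[of \<pi> \<alpha>s] * by simp
  qed
qed

lemma sum_indecomposable_iff:
  assumes "is_permutation \<sigma>"
  shows "sum_indecomposable \<sigma> \<longleftrightarrow> (\<forall>x. \<not> cut (<) \<sigma> x)"
proof
  assume ind: "sum_indecomposable \<sigma>"
  show "\<forall>x. \<not> cut (<) \<sigma> x"
  proof (intro allI notI)
    fix x assume "cut (<) \<sigma> x"
    then obtain \<pi> \<alpha>s where "is_permutation \<pi>" "sorted_wrt (<) \<pi>" "length \<pi> = 2" "length \<alpha>s = 2"
      "\<forall>\<alpha>\<in>set \<alpha>s. is_permutation \<alpha>" "\<sigma> = inflate \<pi> \<alpha>s"
      using inflate_of_cut[OF disjI1[OF refl] assms] by metis
    moreover from this have "\<pi> = increasing_perm 2" using increasing_perm_eqI by metis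
    ultimately show False using ind unfolding sum_indecomposable_def by (metis order_refl)
  qed
next
  assume no: "\<forall>x. \<not> cut (<) \<sigma> x"
  show "sum_indecomposable \<sigma>"
    unfolding sum_indecomposable_def
  proof (intro notI, elim exE conjE)
    fix \<alpha>s :: "nat list list"
    assume *: "2 \<le> length \<alpha>s" "\<forall>\<alpha>\<in>set \<alpha>s. is_permutation \<alpha>" "\<sigma> = inflate (increasing_perm (length \<alpha>s)) \<alpha>s"
    then show False
      using cut_inflate[of "(<)" "increasing_perm (length \<alpha>s)" \<alpha>s] is_permutation_increasing_perm no by auto
  qed
qed

lemma skew_indecomposable_iff:
  assumes "is_permutation \<sigma>"
  shows "skew_indecomposable \<sigma> \<longleftrightarrow> (\<forall>x. \<not> cut (>) \<sigma> x)"
proof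
  assume ind: "skew_indecomposable \<sigma>"
  show "\<forall>x. \<not> cut (>) \<sigma> x"
  proof (intro allI notI)
    fix x assume "cut (>) \<sigma> x"
    then obtain \<pi> \<alpha>s where "is_permutation \<pi>" "sorted_wrt (>) \<pi>" "length \<pi> = 2" "length \<alpha>s = 2"
      "\<forall>\<alpha>\<in>set \<alpha>s. is_permutation \<alpha>" "\<sigma> = inflate \<pi> \<alpha>s"
      using inflate_of_cut[OF disjI2[OF refl] assms] by metis
    moreover from this have "\<pi> = decreasing_perm 2" using decreasing_perm_eqI by metis
    ultimately show False using ind unfolding skew_indecomposable_def by (metis order_refl)
  qed
next
  assume no: "\<forall>x. \<not> cut (>) \<sigma> x"
  show "skew_indecomposable \<sigma>"
    unfolding skew_indecomposable_def
  proof (intro notI, elim exE conjE)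
    fix \<alpha>s :: "nat list list"
    assume *: "2 \<le> length \<alpha>s" "\<forall>\<alpha>\<in>set \<alpha>s. is_permutation \<alpha>" "\<sigma> = inflate (decreasing_perm (length \<alpha>s)) \<alpha>s"
    then show False
      using cut_inflate[of "(>)" "decreasing_perm (length \<alpha>s)" \<alpha>s] is_permutation_decreasing_perm no by auto
  qed
qed

section \<open>Existence of the substitution decomposition\<close>

lemma simple_permutation_spans:
  assumes "is_permutation \<pi>"
  shows "simple_permutation \<pi> \<longleftrightarrow> 4 \<le> length \<pi> \<and>
    (\<forall>a b. (a, b) \<in> interval_spans \<pi> \<longrightarrow> a = b \<or> a = 0 \<and> Suc b = length \<pi>)"
proof -
  let ?k = "length \<pi>"
  have dist: "distinct \<pi>" and set: "set \<pi> = {1..?k}" and "\<pi> \<noteq> []"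
    using assms by (auto simp: is_permutation_def)
  then have k: "0 < ?k" by simp
  have whole: "(!) \<pi> ` {0..?k - 1} = {1..?k}"
  proof -
    have "{0..?k - 1} = {..<?k}" using k by (cases ?k) auto
    then show ?thesis unfolding set[symmetric] by (auto simp: set_conv_nth)
  qed
  have full: "(0, ?k - 1) \<in> interval_spans \<pi>" by (rule interval_spansI) (use k in auto)
  have singles: "(\<lambda>v. {v}) ` {1..?k} = (\<lambda>i. (!) \<pi> ` {i..i}) ` {..<?k}"
    unfolding set[symmetric] by (auto simp: set_conv_nth)
  have card: "card ((!) \<pi> ` {a..b}) = Suc b - a" if "(a, b) \<in> interval_spans \<pi>" for a b
  proof -
    have "b < ?k" using interval_spans_bounds[OF that] by simp
    then have "inj_on ((!) \<pi>) {a..b}" using dist by (auto simp: inj_on_def nth_eq_iff_index_eq)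
    then show ?thesis by (simp add: card_image)
  qed
  have "intervals \<pi> = insert {1..?k} ((\<lambda>v. {v}) ` {1..?k}) \<longleftrightarrow>
      (\<forall>a b. (a, b) \<in> interval_spans \<pi> \<longrightarrow> a = b \<or> a = 0 \<and> Suc b = ?k)"
  proof (intro iffI allI impI)
    fix a b assume eq: "intervals \<pi> = insert {1..?k} ((\<lambda>v. {v}) ` {1..?k})"
      and ab: "(a, b) \<in> interval_spans \<pi>"
    have le: "a \<le> b" "b < ?k" using interval_spans_bounds[OF ab] by auto
    have "(!) \<pi> ` {a..b} \<in> intervals \<pi>"
      unfolding intervals_eq_spans[OF assms] using ab by (intro image_eqI[of _ _ "(a, b)"]) auto
    then have "(!) \<pi> ` {a..b} = {1..?k} \<or> (\<exists>v. (!) \<pi> ` {a..b} = {v})" unfolding eq by blast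
    then have "Suc b - a = ?k \<or> Suc b - a = 1"
      unfolding card[OF ab, symmetric] by auto
    then show "a = b \<or> a = 0 \<and> Suc b = ?k" using le by linarith
  next
    assume trivial: "\<forall>a b. (a, b) \<in> interval_spans \<pi> \<longrightarrow> a = b \<or> a = 0 \<and> Suc b = ?k"
    have "interval_spans \<pi> = insert (0, ?k - 1) ((\<lambda>i. (i, i)) ` {..<?k})"
    proof (intro equalityI subsetI)
      fix p assume p: "p \<in> interval_spans \<pi>"
      obtain a b where ab: "p = (a, b)" by (metis surj_pair)
      have "a = b \<or> a = 0 \<and> Suc b = ?k" using trivial p ab by blast
      then show "p \<in> insert (0, ?k - 1) ((\<lambda>i. (i, i)) ` {..<?k})"
        using interval_spans_bounds[OF p] ab by auto
    qed (use full in \<open>auto intro: singleton_in_interval_spans\<close>)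
    then show "intervals \<pi> = insert {1..?k} ((\<lambda>v. {v}) ` {1..?k})"
      unfolding intervals_eq_spans[OF assms] singles using whole by (simp add: image_image)
  qed
  then show ?thesis using assms by (simp add: simple_permutation_def)
qed

lemma tight_substitution_decomposition:
  assumes "is_substitution_decomposition \<sigma> (\<pi>, \<alpha>s)"
  shows "is_permutation \<pi>" "tight_inflation \<pi> \<alpha>s"
proof -
  have perms: "\<forall>\<alpha>\<in>set \<alpha>s. is_permutation \<alpha>" and cases:
    "simple_permutation \<pi>
      \<or> length \<pi> \<ge> 2 \<and> \<pi> = increasing_perm (length \<pi>) \<and> (\<forall>\<alpha>\<in>set \<alpha>s. sum_indecomposable \<alpha>)
      \<or> length \<pi> \<ge> 2 \<and> \<pi> = decreasing_perm (length \<pi>) \<and> (\<forall>\<alpha>\<in>set \<alpha>s. skew_indecomposable \<alpha>)"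
    using assms by (auto simp: is_substitution_decomposition_def)
  show perm: "is_permutation \<pi>"
    using cases is_permutation_increasing_perm(1)[of "length \<pi>"] is_permutation_decreasing_perm(1)[of "length \<pi>"]
    by (auto simp: simple_permutation_def)
  show "tight_inflation \<pi> \<alpha>s"
    unfolding tight_inflation_def simple_permutation_spans[OF perm, symmetric]
    using cases perms is_permutation_increasing_perm(3)[of "length \<pi>"] is_permutation_decreasing_perm(3)[of "length \<pi>"]
      sum_indecomposable_iff skew_indecomposable_iff by metis
qed

text \<open>Among the ways to write \<open>\<sigma>\<close> as a direct (or skew) sum, one with the largest number of blocks has
  blocks without cuts, since a cut would split a block in two.\<close>

lemma finest_blockwise_inflate:
  assumes R: "R = (<) \<or> R = (>)" and perm: "is_permutation \<sigma>" and cut: "cut R \<sigma> x"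
  obtains \<pi> \<alpha>s where "is_permutation \<pi>" "sorted_wrt R \<pi>" "2 \<le> length \<pi>" "length \<alpha>s = length \<pi>"
    "\<forall>\<alpha>\<in>set \<alpha>s. is_permutation \<alpha>" "\<sigma> = inflate \<pi> \<alpha>s" "\<forall>\<alpha>\<in>set \<alpha>s. \<forall>x. \<not> cut R \<alpha> x"
proof -
  let ?P = "\<lambda>bs. concat bs = \<sigma> \<and> [] \<notin> set bs \<and> blockwise R bs"
  have P: "?P [take x \<sigma>, drop x \<sigma>]" using cut by (auto simp: cut_blockwise)
  have bounded: "length bs < Suc (length \<sigma>)" if "?P bs" for bs
  proof -
    have "length bs \<le> length (concat bs)" if "[] \<notin> set bs" for bs :: "nat list list"
      using that
    proof (induction bs)
      case (Cons b bs)
      then have "0 < length b" by auto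
      with Cons show ?case by (simp add: Suc_le_eq del: length_greater_0_conv)
    qed simp
    then show ?thesis using that by (auto simp: less_Suc_eq_le)
  qed
  then obtain bs where bs: "?P bs" and max: "\<And>cs. ?P cs \<Longrightarrow> length cs \<le> length bs"
    using ex_has_greatest_nat[of ?P, OF P, of length "Suc (length \<sigma>)"] by blast
  have two: "2 \<le> length bs" using max[OF P] by simp
  have no_cut: "\<not> cut R (bs ! i) y" if i: "i < length bs" for i y
  proof
    assume cut: "cut R (bs ! i) y"
    let ?b = "bs ! i"
    let ?cs = "take i bs @ [take y ?b, drop y ?b] @ drop (Suc i) bs"
    have split: "bs = take i bs @ ?b # drop (Suc i) bs" by (rule id_take_nth_drop[OF i])
    have c: "0 < y" "y < length ?b" "blockwise R [take y ?b, drop y ?b]"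
      using cut by (auto simp: cut_blockwise)
    have "concat ?cs = concat (take i bs @ ?b # drop (Suc i) bs)" by (simp flip: append_assoc)
    then have "concat ?cs = \<sigma>" using bs split by metis
    moreover have "[] \<notin> set ?cs"
      using bs c by (auto dest: in_set_takeD in_set_dropD)
    moreover have "blockwise R ?cs"
    proof -
      have "blockwise R (take i bs @ ?b # drop (Suc i) bs)" using bs split by metis
      then show ?thesis using c
        by (auto simp: blockwise_def sorted_wrt_append dest!: in_set_takeD[of _ y ?b] in_set_dropD[of _ y ?b])
    qed
    ultimately have "length ?cs \<le> length bs" using max by blast
    then show False using i by simp
  qed
  have ib: "interval_blocks \<sigma> bs" using blockwise_convex[OF perm _ _ R] bs by blast
  show thesis
  proof (rule interval_blocks_inflate[OF perm ib])
    fix \<pi> \<alpha>s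
    assume *: "is_permutation \<pi>" "length \<pi> = length bs" "length \<alpha>s = length bs"
      "\<forall>\<alpha>\<in>set \<alpha>s. is_permutation \<alpha>" "\<sigma> = inflate \<pi> \<alpha>s"
      and shift: "\<And>i. i < length bs \<Longrightarrow> \<exists>s. bs ! i = map (\<lambda>x. x + s) (\<alpha>s ! i)"
      and less: "\<And>i j x' y. i < length bs \<Longrightarrow> j < length bs \<Longrightarrow> i \<noteq> j \<Longrightarrow> x' \<in> set (bs ! i) \<Longrightarrow>
        y \<in> set (bs ! j) \<Longrightarrow> x' < y \<longleftrightarrow> \<pi> ! i < \<pi> ! j"
    have "sorted_wrt R \<pi>"
      by (rule blockwise_outer_sorted[OF R _ _ *(2) less]) (use bs in auto)
    moreover have "\<not> cut R \<alpha> y" if \<alpha>: "\<alpha> \<in> set \<alpha>s" for \<alpha> y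
    proof -
      obtain i where i: "i < length bs" "\<alpha> = \<alpha>s ! i" using \<alpha> *(3) by (auto simp: in_set_conv_nth)
      obtain s where "bs ! i = map (\<lambda>x. x + s) \<alpha>" using shift[OF i(1)] i(2) by blast
      then show ?thesis using no_cut[OF i(1), of y] cut_map_add[OF R] by metis
    qed
    ultimately show thesis using that[of \<pi> \<alpha>s] * two by metis
  qed
qed

text \<open>Among the ways to write \<open>\<sigma>\<close> as a sequence of at least two interval blocks, take one with the fewest
  blocks.  A nontrivial interval of the outer permutation could be merged into a single block, so there
  is none.  Two blocks would give a cut of \<open>\<sigma>\<close>, and three blocks are impossible because every permutation
  of three letters has an interval of two letters.\<close>

lemma coarsest_blocks_inflate:
  assumes perm: "is_permutation \<sigma>" and len: "2 \<le> length \<sigma>"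
    and no_cut: "\<And>x. \<not> cut (<) \<sigma> x" "\<And>x. \<not> cut (>) \<sigma> x"
  obtains \<pi> \<alpha>s where "simple_permutation \<pi>" "length \<alpha>s = length \<pi>"
    "\<forall>\<alpha>\<in>set \<alpha>s. is_permutation \<alpha>" "\<sigma> = inflate \<pi> \<alpha>s"
proof -
  let ?P = "\<lambda>bs. interval_blocks \<sigma> bs \<and> 2 \<le> length bs"
  have "?P (map (\<lambda>x. [x]) \<sigma>)" using len by (auto simp: interval_blocks_def convex_values_def)
  then obtain bs where bs: "interval_blocks \<sigma> bs" "2 \<le> length bs"
    and min: "\<And>cs. ?P cs \<Longrightarrow> length bs \<le> length cs"
    using ex_has_least_nat[of ?P _ length] by blast
  have concat: "concat bs = \<sigma>" and ne: "[] \<notin> set bs"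
    and conv: "\<And>i. i < length bs \<Longrightarrow> convex_values (set (bs ! i))"
    using bs(1) by (auto simp: interval_blocks_def)
  show thesis
  proof (rule interval_blocks_inflate[OF perm bs(1)])
    fix \<pi> \<alpha>s
    assume *: "is_permutation \<pi>" "length \<pi> = length bs" "length \<alpha>s = length bs"
      "\<forall>\<alpha>\<in>set \<alpha>s. is_permutation \<alpha>" "\<sigma> = inflate \<pi> \<alpha>s"
      and less: "\<And>i j x y. i < length bs \<Longrightarrow> j < length bs \<Longrightarrow> i \<noteq> j \<Longrightarrow> x \<in> set (bs ! i) \<Longrightarrow>
        y \<in> set (bs ! j) \<Longrightarrow> x < y \<longleftrightarrow> \<pi> ! i < \<pi> ! j"
    have trivial: "a = b \<or> a = 0 \<and> Suc b = length \<pi>" if ab: "(a, b) \<in> interval_spans \<pi>" for a b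
    proof (rule ccontr)
      assume nt: "\<not> ?thesis"
      have le: "a < b" "b < length bs" using interval_spans_bounds[OF ab] nt *(2) by auto
      let ?m = "concat (take (Suc b - a) (drop a bs))"
      let ?cs = "take a bs @ [?m] @ drop (Suc b) bs"
      have drop: "drop a bs = take (Suc b - a) (drop a bs) @ drop (Suc b) bs"
        using append_take_drop_id[of "Suc b - a" "drop a bs"] le by simp
      have "concat ?cs = concat (take a bs @ take (Suc b - a) (drop a bs) @ drop (Suc b) bs)" by simp
      then have "concat ?cs = \<sigma>" unfolding drop[symmetric] using concat by simp
      moreover have m: "v \<in> set ?m \<longleftrightarrow> (\<exists>i. a \<le> i \<and> i \<le> b \<and> v \<in> set (bs ! i))" for v
      proof
        assume "v \<in> set ?m"
        then obtain t where "t < Suc b - a" "v \<in> set (bs ! (a + t))"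
          using le by (auto simp: in_set_conv_nth[of _ "take (Suc b - a) (drop a bs)"])
        then show "\<exists>i. a \<le> i \<and> i \<le> b \<and> v \<in> set (bs ! i)" by (intro exI[of _ "a + t"]) auto
      next
        assume "\<exists>i. a \<le> i \<and> i \<le> b \<and> v \<in> set (bs ! i)"
        then obtain i where i: "a \<le> i" "i \<le> b" "v \<in> set (bs ! i)" by blast
        then have "take (Suc b - a) (drop a bs) ! (i - a) \<in> set (take (Suc b - a) (drop a bs))"
          using le by (intro nth_mem) auto
        then have "bs ! i \<in> set (take (Suc b - a) (drop a bs))" using i le by auto
        then show "v \<in> set ?m" using i(3) by auto
      qed
      have "convex_values (set ?m)"
        unfolding convex_values_def
      proof (intro ballI allI impI, elim conjE)
        fix x y z assume x: "x \<in> set ?m" and z: "z \<in> set ?m" and lt: "x < y" "y < z"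
        obtain u v where u: "a \<le> u" "u \<le> b" "x \<in> set (bs ! u)" and v: "a \<le> v" "v \<le> b" "z \<in> set (bs ! v)"
          using x z m by blast
        have uv: "u < length bs" "v < length bs" using u v le by auto
        have "x \<in> set \<sigma>" "z \<in> set \<sigma>" using u v uv unfolding concat[symmetric] in_set_concat_iff by blast+
        then have "y \<in> set \<sigma>" using lt perm by (auto simp: is_permutation_def)
        then obtain w where w: "w < length bs" "y \<in> set (bs ! w)"
          unfolding concat[symmetric] in_set_concat_iff by blast
        have "a \<le> w \<and> w \<le> b"
        proof (cases "w = u \<or> w = v")
          case False
          then have "\<pi> ! u < \<pi> ! w" "\<pi> ! w < \<pi> ! v"
            using less[OF uv(1) w(1) _ u(3) w(2)] less[OF w(1) uv(2) _ w(2) v(3)] lt by auto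
          then show ?thesis using interval_spansD[OF ab] u v w *(2) by metis
        qed (use u v in auto)
        then show "y \<in> set ?m" using m w by blast
      qed
      moreover have "?m \<noteq> []"
      proof -
        have "bs ! a \<in> set bs" using le by simp
        then have "bs ! a \<noteq> []" using ne by metis
        then have "hd (bs ! a) \<in> set ?m" using m[of "hd (bs ! a)"] le by auto
        then show ?thesis by (metis empty_iff empty_set)
      qed
      ultimately have "interval_blocks \<sigma> ?cs"
        using bs(1) by (auto simp: interval_blocks_def dest: in_set_takeD in_set_dropD)
      moreover have "2 \<le> length ?cs" using nt le *(2) by auto
      ultimately have "length bs \<le> length ?cs" using min by blast
      then show False using le by simp
    qed
    \<comment> \<open>the two blocks have disjoint ranges of values, so one lies entirely below the other\<close>
    have "length bs \<noteq> 2"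
    proof
      assume two: "length bs = 2"
      then obtain b c where bc: "bs = [b, c]"
        by (metis (no_types, lifting) One_nat_def Suc_1 length_0_conv length_Suc_conv)
      have split: "take (length b) \<sigma> = b" "drop (length b) \<sigma> = c" "b \<noteq> []" "c \<noteq> []"
        using concat ne bc by auto
      then have l: "0 < length b" "length b < length \<sigma>" using concat bc by auto
      have "distinct \<pi>" using *(1) by (simp add: is_permutation_def)
      then have "\<pi> ! 0 \<noteq> \<pi> ! 1" using *(2) two by (simp add: nth_eq_iff_index_eq)
      moreover have "u < v \<longleftrightarrow> \<pi> ! 0 < \<pi> ! 1" "v < u \<longleftrightarrow> \<pi> ! 1 < \<pi> ! 0"
        if "u \<in> set b" "v \<in> set c" for u v
        using less[of 0 1 u v] less[of 1 0 v u] that by (simp_all add: bc)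
      ultimately have "blockwise (<) [b, c] \<or> blockwise (>) [b, c]"
        by (cases "\<pi> ! 0 < \<pi> ! 1") (simp_all add: blockwise_def)
      then show False using no_cut[of "length b"] l unfolding cut_blockwise split by blast
    qed
    moreover have "length bs \<noteq> 3"
    proof
      assume three: "length bs = 3"
      have "(0, 1) \<notin> interval_spans \<pi>" "(1, 2) \<notin> interval_spans \<pi>"
        using trivial[of 0 1] trivial[of 1 2] *(2) three by auto
      \<comment> \<open>\<open>{0..1}\<close> fails to be an interval only if the last value lies between the first two, and
        then the first value does not lie between the last two\<close>
      moreover have "(0, 1) \<in> interval_spans \<pi> \<or> (1, 2) \<in> interval_spans \<pi>"
      proof (cases "(\<pi> ! 0 < \<pi> ! 2 \<and> \<pi> ! 2 < \<pi> ! 1) \<or> (\<pi> ! 1 < \<pi> ! 2 \<and> \<pi> ! 2 < \<pi> ! 0)")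
        case True
        have "(1, 2) \<in> interval_spans \<pi>"
        proof (rule interval_spansI)
          fix i j k assume "1 \<le> i" "i \<le> 2" "1 \<le> j" "j \<le> 2" "k < length \<pi>"
            "\<pi> ! i < \<pi> ! k" "\<pi> ! k < \<pi> ! j"
          moreover from this have "i = 1 \<or> i = 2" "j = 1 \<or> j = 2" "k = 0 \<or> k = 1 \<or> k = 2"
            using *(2) three by auto
          ultimately show "1 \<le> k \<and> k \<le> 2" using True by fastforce
        qed (use *(2) three in auto)
        then show ?thesis ..
      next
        case False
        have "(0, 1) \<in> interval_spans \<pi>"
        proof (rule interval_spansI)
          fix i j k assume "0 \<le> i" "i \<le> 1" "0 \<le> j" "j \<le> 1" "k < length \<pi>"
            "\<pi> ! i < \<pi> ! k" "\<pi> ! k < \<pi> ! j"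
          moreover from this have "i = 0 \<or> i = 1" "j = 0 \<or> j = 1" "k = 0 \<or> k = 1 \<or> k = 2"
            using *(2) three by auto
          ultimately show "0 \<le> k \<and> k \<le> 1" using False by fastforce
        qed (use *(2) three in auto)
        then show ?thesis ..
      qed
      ultimately show False by blast
    qed
    ultimately have "4 \<le> length \<pi>" using bs(2) *(2) by linarith
    then have "simple_permutation \<pi>"
      unfolding simple_permutation_spans[OF *(1)] using trivial by blast
    then show thesis using that[of \<pi> \<alpha>s] * by metis
  qed
qed

text \<open>A cut leads to one of the two monotone cases, and coarsest interval blocks give the simple case when
  no cut exists.\<close>

lemma substitution_decomposition_exists:
  assumes perm: "is_permutation \<sigma>" and len: "2 \<le> length \<sigma>"
  shows "\<exists>d. is_substitution_decomposition \<sigma> d"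
proof -
  consider (up) x where "cut (<) \<sigma> x" | (down) x where "cut (>) \<sigma> x"
    | (simple) "\<And>x. \<not> cut (<) \<sigma> x" "\<And>x. \<not> cut (>) \<sigma> x" by blast
  then show ?thesis
  proof cases
    case up
    obtain \<pi> \<alpha>s where *: "is_permutation \<pi>" "sorted_wrt (<) \<pi>" "2 \<le> length \<pi>" "length \<alpha>s = length \<pi>"
      "\<forall>\<alpha>\<in>set \<alpha>s. is_permutation \<alpha>" "\<sigma> = inflate \<pi> \<alpha>s" "\<forall>\<alpha>\<in>set \<alpha>s. \<forall>x. \<not> cut (<) \<alpha> x"
      using finest_blockwise_inflate[OF disjI1[OF refl] perm up] .
    then have "is_substitution_decomposition \<sigma> (\<pi>, \<alpha>s)"
      using increasing_perm_eqI[OF *(1,2)] sum_indecomposable_iff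
      by (auto simp: is_substitution_decomposition_def)
    then show ?thesis ..
  next
    case down
    obtain \<pi> \<alpha>s where *: "is_permutation \<pi>" "sorted_wrt (>) \<pi>" "2 \<le> length \<pi>" "length \<alpha>s = length \<pi>"
      "\<forall>\<alpha>\<in>set \<alpha>s. is_permutation \<alpha>" "\<sigma> = inflate \<pi> \<alpha>s" "\<forall>\<alpha>\<in>set \<alpha>s. \<forall>x. \<not> cut (>) \<alpha> x"
      using finest_blockwise_inflate[OF disjI2[OF refl] perm down] .
    then have "is_substitution_decomposition \<sigma> (\<pi>, \<alpha>s)"
      using decreasing_perm_eqI[OF *(1,2)] skew_indecomposable_iff
      by (auto simp: is_substitution_decomposition_def)
    then show ?thesis ..
  next
    case simple
    obtain \<pi> \<alpha>s where "simple_permutation \<pi>" "length \<alpha>s = length \<pi>"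
      "\<forall>\<alpha>\<in>set \<alpha>s. is_permutation \<alpha>" "\<sigma> = inflate \<pi> \<alpha>s"
      using coarsest_blocks_inflate[OF perm len simple] .
    then have "is_substitution_decomposition \<sigma> (\<pi>, \<alpha>s)"
      by (auto simp: is_substitution_decomposition_def)
    then show ?thesis ..
  qed
qed

section \<open>Comparison of the two embedded posets\<close>

lemma Qtilde_span_isomorphism:
  "is_permutation \<sigma> \<Longrightarrow> \<exists>f. span_isomorphism \<sigma> (Qtilde \<sigma>) f"
proof (induction \<sigma> rule: measure_induct_rule[of length])
  case (less \<sigma>)
  note perm = less.prems
  show ?case
  proof (cases "\<sigma> = [1]")
    case True
    have "(a, b) \<in> interval_spans [1] \<longleftrightarrow> a = 0 \<and> b = 0" for a b
      by (auto simp: interval_spans_def)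
    then have "interval_spans \<sigma> = {(0, 0)}" using True by auto
    moreover have "Qtilde \<sigma> = \<lparr>nodes = {[]}, order = {([], [])}, left = {}\<rparr>"
      unfolding True by (subst Qtilde.simps) simp
    ultimately have "span_isomorphism \<sigma> (Qtilde \<sigma>) (\<lambda>_. (0, 0))"
      by (auto simp: span_isomorphism_def bij_betw_def)
    then show ?thesis by blast
  next
    case False
    have "length \<sigma> \<noteq> 1"
    proof
      assume "length \<sigma> = 1"
      then obtain v where "\<sigma> = [v]" by (auto simp: length_Suc_conv)
      then show False using perm False by (auto simp: is_permutation_def)
    qed
    moreover have "\<sigma> \<noteq> []" using perm by (simp add: is_permutation_def)
    ultimately have "2 \<le> length \<sigma>" by (cases \<sigma>; cases "tl \<sigma>") auto
    then have ex: "\<exists>d. is_substitution_decomposition \<sigma> d"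
      by (rule substitution_decomposition_exists[OF perm])
    obtain \<pi> \<alpha>s where sd: "substitution_decomposition \<sigma> = (\<pi>, \<alpha>s)" by (metis surj_pair)
    have d: "is_substitution_decomposition \<sigma> (\<pi>, \<alpha>s)"
      using someI_ex[OF ex] sd by (simp add: substitution_decomposition_def)
    then have \<sigma>: "\<sigma> = inflate \<pi> \<alpha>s" and len: "length \<alpha>s = length \<pi>"
      and perms: "\<forall>\<alpha>\<in>set \<alpha>s. is_permutation \<alpha>"
      and shape: "simple_permutation \<pi> \<or> \<pi> = increasing_perm (length \<pi>) \<or> \<pi> = decreasing_perm (length \<pi>)"
      by (auto simp: is_substitution_decomposition_def)
    note tight = tight_substitution_decomposition[OF d]
    have Q: "Qtilde \<sigma> = replace_minimals (Rtilde \<pi>) (map Qtilde \<alpha>s)"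
      using False ex sd by (subst Qtilde.simps) simp
    have R: "span_isomorphism \<pi> (Rtilde \<pi>) (\<lambda>I. (first_position \<pi> I, last_position \<pi> I))"
      unfolding Rtilde_eq_Ptilde[OF shape] by (rule span_isomorphism_Ptilde[OF tight(1)])
    have "\<exists>f. span_isomorphism (\<alpha>s ! i) (Qtilde (\<alpha>s ! i)) f" if "i < length \<pi>" for i
    proof (rule less.IH)
      show "length (\<alpha>s ! i) < length \<sigma>"
        using length_substitution_decomposition[OF d, of "\<alpha>s ! i"] that len by simp
    qed (use perms that len in simp)
    then obtain f where f: "\<And>i. i < length \<pi> \<Longrightarrow> span_isomorphism (\<alpha>s ! i) (Qtilde (\<alpha>s ! i)) (f i)"
      by metis
    have "\<exists>h. span_isomorphism (inflate \<pi> \<alpha>s) (replace_minimals (Rtilde \<pi>) (map Qtilde \<alpha>s)) h"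
    proof (rule replace_minimals_span_isomorphism[OF _ len perms tight(2) R])
      show "distinct \<pi>" using tight(1) by (simp add: is_permutation_def)
      show "span_isomorphism (\<alpha>s ! i) (map Qtilde \<alpha>s ! i) (f i)" if "i < length \<pi>" for i
        using f[OF that] that len by simp
    qed
    then show ?thesis unfolding Q \<sigma>[symmetric] .
  qed
qed

theorem proposition9:
  fixes \<sigma> :: "nat list"
  assumes "is_permutation \<sigma>"
  shows "inj_on (represented \<sigma> (Qtilde \<sigma>)) (nodes (Qtilde \<sigma>)) \<and>
    rename (represented \<sigma> (Qtilde \<sigma>)) (Qtilde \<sigma>) = Ptilde \<sigma>"
  using Qtilde_span_isomorphism[OF assms] represented_isomorphism_Ptilde[OF assms] by blast

end
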